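(* Let $1\le r\le N$ and let $\mathcal{G}_r(N)=\{X\in\mathbb{R}^{N\times N}:X^\top=X,\ X^2=X,\ \mathrm{tr}(X)=r\}$ be the Grassmann manifold. Let $\kappa>0$ be a $C^{(1,1)}$ kernel on $\mathcal{G}_r(N)$ and let $p_\theta(X)\propto\exp(\theta^\top\zeta(X)+\eta(X))$, $\theta\in\mathbb{R}^s$, with $\zeta=(\zeta_1,\dots,\zeta_s)^\top\in C^1(\mathcal{G}_r(N),\mathbb{R}^s)$ and $\eta\in C^1(\mathcal{G}_r(N),\mathbb{R})$. Let $Q(X,Y)\in\mathbb{R}^{s\times s}$ and $b(X,Y)\in\mathbb{R}^s$ be given by $$Q(X,Y)_{kl}=\kappa(X,Y)\,\langle\mathscr{A}[\mathscr{S}(\nabla^{\mathbb{R}}_X\zeta_k)X],\mathscr{A}[\mathscr{S}(\nabla^{\mathbb{R}}_Y\zeta_l)Y]\rangle_F,$$ $$b(X,Y)_k=\kappa(X,Y)\,\langle\mathscr{A}[\mathscr{S}(\nabla^{\mathbb{R}}_X\log(e^\eta\kappa))X],\mathscr{A}[\mathscr{S}(\nabla^{\mathbb{R}}_Y\zeta_k)Y]\rangle_F.$$ Let $n\ge2$, $x_1,\dots,x_n\in\mathcal{G}_r(N)$, let $q^w:\mathcal{G}_r(N)\to[0,\infty)$ be a weight function, and set $$Q_u=\sum_{i\ne j}\frac{Q(x_i,x_j)}{n(n-1)}q^w(x_i)q^w(x_j),\quad b_u=\sum_{i\ne j}\frac{b(x_i,x_j)}{n(n-1)}q^w(x_i)q^w(x_j),$$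 $$Q_v=\sum_{i,j}\frac{Q(x_i,x_j)}{n^2}q^w(x_i)q^w(x_j),\quad b_v=\sum_{i,j}\frac{b(x_i,x_j)}{n^2}q^w(x_i)q^w(x_j).$$ Then the minimum kernel Stein discrepancy estimators can be computed by the following formulas: if $Q_u$ is positive semi-definite, the sets of global minimizers of $U^w_n$ and $V^w_n$ over $\theta\in\mathbb{R}^s$ are $$\operatorname{argmin}U^w_n(\theta)=\{-Q_u^+b_u-(I-Q_u^+Q_u)x:x\in\mathbb{R}^s\},$$ $$\operatorname{argmin}V^w_n(\theta)=\{-Q_v^+b_v-(I-Q_v^+Q_v)x:x\in\mathbb{R}^s\},$$ where $^+$ denotes the Moore–Penrose inverse.
   Context: $\langle A,B\rangle_F=\mathrm{tr}(A^\top B)$, $\mathscr{A}(A)=(A-A^\top)/2$ and $\mathscr{S}(A)=(A+A^\top)/2$. $E_{ij}$ is the $N\times N$ matrix with a $1$ in entry $(i,j)$ and zeros elsewhere, $\mathcal{E}_{ij}=\frac{\sqrt2}{2}(E_{ij}-E_{ji})$ for $i<j$, and $K^{ij}$ is the killing field $K^{ij}_X=\mathcal{E}_{ij}X-X\mathcal{E}_{ij}$ on $\mathcal{G}_r(N)$ (from the action $O.X=OXO^\top$ of $O(N)$). For bivariate functions, $K^{ij}_X$, $K^{ij}_Y$ act on the first and second argument. A kernel is real-valued, symmetric, positive semi-definite; $C^{(1,1)}$ means once continuously differentiable in each argument with continuous mixed derivative of order $(1,1)$. For a density $p>0$, $$\kappa_p(X,Y)=\kappa(X,Y)\sum_{i<j}\left[K^{ij}_X\log(p(X)\kappa(X,Y))\cdot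 K^{ij}_Y\log(p(Y)\kappa(X,Y))+K^{ij}_YK^{ij}_X\log\kappa(X,Y)\right],$$ and the (weighted) empirical kernel Stein discrepancies are $$U^w_n(\theta)=\frac{1}{n(n-1)}\sum_{i\ne j}\kappa_{p_\theta}(x_i,x_j)q^w(x_i)q^w(x_j),\qquad V^w_n(\theta)=\frac1{n^2}\sum_{i,j}\kappa_{p_\theta}(x_i,x_j)q^w(x_i)q^w(x_j);$$ the minimum kernel Stein discrepancy estimator (MKSDE) is a global minimizer of $U^w_n$ or $V^w_n$. The unweighted case is $q^w\equiv1$. For $f$ on a submanifold $M\subset\mathbb{R}^{N\times N}$, a Euclidean gradient $\nabla^{\mathbb{R}}_Xf$ is any matrix in $\mathbb{R}^{N\times N}$ with $D_Xf=\langle\nabla^{\mathbb{R}}_Xf,D_X\rangle_F$ for all $D_X\in T_XM$ (any choice may be used). $\nabla^{\mathbb{R}}_X\log(e^\eta\kappa)$ is the gradient of $X\mapsto\eta(X)+\log\kappa(X,Y)$ with $Y$ fixed.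
   Formalization: The formula for argmin U is asserted only when U has a global minimizer, which is shown to hold exactly when b_u lies in the range of Q_u; otherwise (e.g. Q_u = 0, b_u ≠ 0) U is unbounded below and the printed formula fails. *)

theory Defs
  imports "HOL-Analysis.Analysis"
begin

section \<open>Matrices\<close>

type_synonym 'n sqmat = "((real, 'n) vec, 'n) vec"

definition frob :: "real^'n^'n \<Rightarrow> real^'n^'n \<Rightarrow> real" where
  "frob A B = trace (transpose A ** B)"

definition skew_part :: "real^'n^'n \<Rightarrow> real^'n^'n" where
  "skew_part A = (1/2) *\<^sub>R (A - transpose A)"

definition sym_part :: "real^'n^'n \<Rightarrow> real^'n^'n" where
  "sym_part A = (1/2) *\<^sub>R (A + transpose A)"

definition psd_matrix :: "real^'s^'s \<Rightarrow> bool" where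
  "psd_matrix A \<longleftrightarrow> transpose A = A \<and> (\<forall>v. 0 \<le> v \<bullet> (A *v v))"

definition is_moore_penrose :: "real^'n^'m \<Rightarrow> real^'m^'n \<Rightarrow> bool" where
  "is_moore_penrose A B \<longleftrightarrow>
     A ** B ** A = A \<and> B ** A ** B = B \<and>
     transpose (A ** B) = A ** B \<and> transpose (B ** A) = B ** A"

definition moore_penrose :: "real^'n^'m \<Rightarrow> real^'m^'n" where
  "moore_penrose A = (THE B. is_moore_penrose A B)"


section \<open>Calculus on subsets of a normed space\<close>

text \<open>
  For an embedded submanifold \<open>M\<close>, a map on \<open>M\<close> is continuously differentiable (in charts) iff
  near every point of \<open>M\<close> it is the restriction of a continuously differentiable map
  on an open subset of the ambient space. Values outside \<open>M\<close> play no role below.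
\<close>

definition C1_on :: "'a::real_normed_vector set \<Rightarrow> ('a \<Rightarrow> 'b::real_normed_vector) \<Rightarrow> bool" where
  "C1_on M f \<longleftrightarrow>
     (\<forall>x\<in>M. \<exists>U F F'. open U \<and> x \<in> U \<and> (\<forall>y\<in>M \<inter> U. F y = f y) \<and>
        (\<forall>y\<in>U. (F has_derivative blinfun_apply (F' y)) (at y)) \<and> continuous_on U F')"

text \<open>
  Class \<open>C\<^sup>(\<^sup>1\<^sup>,\<^sup>1\<^sup>)\<close>: \<open>K1\<close> and \<open>K2\<close> are the partial derivatives in the first and the second argument,
  \<open>K12\<close> is the mixed derivative.
\<close>

definition C11_on :: "'a::real_normed_vector set \<Rightarrow> ('a \<Rightarrow> 'a \<Rightarrow> real) \<Rightarrow> bool" where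
  "C11_on M \<kappa> \<longleftrightarrow>
     (\<forall>x\<in>M. \<forall>y\<in>M. \<exists>U V K K1 K2 K12.
        open U \<and> open V \<and> x \<in> U \<and> y \<in> V \<and>
        (\<forall>u\<in>M \<inter> U. \<forall>v\<in>M \<inter> V. K u v = \<kappa> u v) \<and>
        (\<forall>u\<in>U. \<forall>v\<in>V.
           ((\<lambda>u'. K u' v) has_derivative blinfun_apply (K1 u v)) (at u) \<and>
           ((\<lambda>v'. K u v') has_derivative blinfun_apply (K2 u v)) (at v) \<and>
           ((\<lambda>v'. K1 u v') has_derivative blinfun_apply (K12 u v)) (at v)) \<and>
        continuous_on (U \<times> V) (\<lambda>(u, v). K1 u v) \<and>
        continuous_on (U \<times> V) (\<lambda>(u, v). K2 u v) \<and>
        continuous_on (U \<times> V) (\<lambda>(u, v). K12 u v))"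

definition curve_in :: "'a::real_normed_vector set \<Rightarrow> 'a \<Rightarrow> 'a \<Rightarrow> (real \<Rightarrow> 'a) \<Rightarrow> bool" where
  "curve_in M x v c \<longleftrightarrow>
     (\<exists>\<epsilon>>0. c ` {-\<epsilon><..<\<epsilon>} \<subseteq> M \<and> c C1_differentiable_on {-\<epsilon><..<\<epsilon>}) \<and>
     c 0 = x \<and> (c has_vector_derivative v) (at 0)"

definition tangent_space :: "'a::real_normed_vector set \<Rightarrow> 'a \<Rightarrow> 'a set" where
  "tangent_space M x = {v. \<exists>c. curve_in M x v c}"

text \<open>The derivative \<open>D\<^sub>x f\<close> of a function on \<open>M\<close> along a tangent vector \<open>v\<close> at \<open>x\<close>.\<close>

definition tangent_deriv :: "'a::real_normed_vector set \<Rightarrow> ('a \<Rightarrow> real) \<Rightarrow> 'a \<Rightarrow> 'a \<Rightarrow> real" where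
  "tangent_deriv M f x v =
     (THE l. \<forall>c. curve_in M x v c \<longrightarrow> ((\<lambda>t. f (c t)) has_real_derivative l) (at 0))"

definition euclidean_gradient ::
    "(real^'n^'n) set \<Rightarrow> (real^'n^'n \<Rightarrow> real) \<Rightarrow> real^'n^'n \<Rightarrow> real^'n^'n \<Rightarrow> bool" where
  "euclidean_gradient M f X G \<longleftrightarrow> (\<forall>D\<in>tangent_space M X. tangent_deriv M f X D = frob G D)"


section \<open>The Grassmann manifold and its killing fields\<close>

definition grassmann :: "nat \<Rightarrow> (real^'n^'n) set" where
  "grassmann r = {X. transpose X = X \<and> X ** X = X \<and> trace X = real r}"

definition E_unit :: "'n \<Rightarrow> 'n \<Rightarrow> real^'n^'n" where
  "E_unit i j = (\<chi> a b. if a = i \<and> b = j then 1 else 0)"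

definition E_skew :: "'n \<Rightarrow> 'n \<Rightarrow> real^'n^'n" where
  "E_skew i j = (sqrt 2 / 2) *\<^sub>R (E_unit i j - E_unit j i)"

text \<open>
  For skew-symmetric \<open>E\<close>, the velocity at \<open>t = 0\<close> of \<open>t \<mapsto> exp (t E) X (exp (t E))\<^sup>T\<close> is \<open>E X - X E\<close>.
\<close>

definition killing :: "nat \<Rightarrow> 'n::finite \<Rightarrow> 'n \<Rightarrow> (real^'n^'n \<Rightarrow> real) \<Rightarrow> real^'n^'n \<Rightarrow> real" where
  "killing r i j f X = tangent_deriv (grassmann r) f X (E_skew i j ** X - X ** E_skew i j)"


section \<open>Kernel Stein discrepancies\<close>

definition psd_kernel :: "'a set \<Rightarrow> ('a \<Rightarrow> 'a \<Rightarrow> real) \<Rightarrow> bool" where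
  "psd_kernel M \<kappa> \<longleftrightarrow>
     (\<forall>x\<in>M. \<forall>y\<in>M. \<kappa> x y = \<kappa> y x) \<and>
     (\<forall>m (y :: nat \<Rightarrow> 'a) (c :: nat \<Rightarrow> real). (\<forall>i<m. y i \<in> M) \<longrightarrow>
        0 \<le> (\<Sum>i<m. \<Sum>j<m. c i * c j * \<kappa> (y i) (y j)))"

definition stein_kernel ::
    "nat \<Rightarrow> ('n::{finite,linorder} sqmat \<Rightarrow> 'n sqmat \<Rightarrow> real) \<Rightarrow> ('n sqmat \<Rightarrow> real) \<Rightarrow>
     'n sqmat \<Rightarrow> 'n sqmat \<Rightarrow> real" where
  "stein_kernel r \<kappa> p X Y =
     \<kappa> X Y * (\<Sum>(i, j) \<in> {(i, j). i < j}.
        killing r i j (\<lambda>X'. ln (p X' * \<kappa> X' Y)) X * killing r i j (\<lambda>Y'. ln (p Y' * \<kappa> X Y')) Y +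
        killing r i j (\<lambda>Y'. killing r i j (\<lambda>X'. ln (\<kappa> X' Y')) X) Y)"

text \<open>Weighted U- and V-statistics of a scalar-, vector- or matrix-valued function \<open>h\<close>.\<close>

definition U_stat ::
    "nat \<Rightarrow> (nat \<Rightarrow> 'a) \<Rightarrow> ('a \<Rightarrow> real) \<Rightarrow> ('a \<Rightarrow> 'a \<Rightarrow> 'b::real_vector) \<Rightarrow> 'b" where
  "U_stat n x q h =
     (1 / (real n * (real n - 1))) *\<^sub>R
       (\<Sum>(i, j) \<in> {(i, j). i \<in> {1..n} \<and> j \<in> {1..n} \<and> i \<noteq> j}.
          (q (x i) * q (x j)) *\<^sub>R h (x i) (x j))"

definition V_stat ::
    "nat \<Rightarrow> (nat \<Rightarrow> 'a) \<Rightarrow> ('a \<Rightarrow> real) \<Rightarrow> ('a \<Rightarrow> 'a \<Rightarrow> 'b::real_vector) \<Rightarrow> 'b" where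
  "V_stat n x q h =
     (1 / (real n)\<^sup>2) *\<^sub>R
       (\<Sum>(i, j) \<in> {1..n} \<times> {1..n}. (q (x i) * q (x j)) *\<^sub>R h (x i) (x j))"

text \<open>
  \<open>g k X\<close> is a Euclidean gradient of \<open>\<zeta>\<^sub>k\<close> at \<open>X\<close>, and \<open>h X Y\<close> is a Euclidean gradient
  of \<open>X' \<mapsto> \<eta> X' + ln (\<kappa> X' Y)\<close> at \<open>X\<close>.
\<close>

definition stein_Q ::
    "(real^'n^'n \<Rightarrow> real^'n^'n \<Rightarrow> real) \<Rightarrow> ('s \<Rightarrow> real^'n^'n \<Rightarrow> real^'n^'n) \<Rightarrow>
     real^'n^'n \<Rightarrow> real^'n^'n \<Rightarrow> real^'s^'s" where
  "stein_Q \<kappa> g X Y = (\<chi> k l. \<kappa> X Y *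
     frob (skew_part (sym_part (g k X) ** X)) (skew_part (sym_part (g l Y) ** Y)))"

definition stein_b ::
    "(real^'n^'n \<Rightarrow> real^'n^'n \<Rightarrow> real) \<Rightarrow> ('s \<Rightarrow> real^'n^'n \<Rightarrow> real^'n^'n) \<Rightarrow>
     (real^'n^'n \<Rightarrow> real^'n^'n \<Rightarrow> real^'n^'n) \<Rightarrow> real^'n^'n \<Rightarrow> real^'n^'n \<Rightarrow> real^'s" where
  "stein_b \<kappa> g h X Y = (\<chi> k. \<kappa> X Y *
     frob (skew_part (sym_part (h X Y) ** X)) (skew_part (sym_part (g k Y) ** Y)))"

definition argmin_set :: "('a \<Rightarrow> real) \<Rightarrow> 'a set" where
  "argmin_set f = {\<theta>. is_arg_min f (\<lambda>_. True) \<theta>}"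

end

theory Submission
  imports Defs
begin

text \<open>
  Along the killing field of \<open>E\<^sub>i\<^sub>j\<close>, a function with Euclidean gradient \<open>G\<close> has derivative
  \<open>2 \<surd>2\<close> times the entry \<open>(i, j)\<close> of the skew part of \<open>\<S>(G) X\<close>. Summing over \<open>i < j\<close> shows that,
  up to a constant, both discrepancies are \<open>4 (\<theta>\<^sup>T Q \<theta> + 2 b\<^sup>T \<theta>)\<close>, with minimizers the solutions of
  \<open>Q \<theta> = - b\<close> when \<open>Q\<close> is positive semi-definite. For the V-statistic, positive semi-definiteness of \<open>\<kappa>\<close>
  gives both
  the semi-definiteness of \<open>Q\<close> and the solvability of this equation. For the U-statistic solvability
  can fail, and then there is no minimizer.
\<close>


section \<open>Matrix multiplication as a bounded bilinear map\<close>

lemma bounded_bilinear_matrix_mult: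
  "bounded_bilinear ((**) :: real^'n^'m \<Rightarrow> real^'p^'n \<Rightarrow> real^'p^'m)"
  unfolding bilinear_conv_bounded_bilinear[symmetric] bilinear_def
  by (auto intro!: linearI simp: matrix_matrix_mult_def vec_eq_iff algebra_simps sum.distrib
      sum_distrib_left)

text \<open>Supplies the product rule for curves of matrices, continuity, and the rules for signs,
  sums and scalars under the prefix \<open>matrix_mult\<close>.\<close>

interpretation matrix_mult: bounded_bilinear "(**) :: real^'n^'m \<Rightarrow> real^'p^'n \<Rightarrow> real^'p^'m"
  by (rule bounded_bilinear_matrix_mult)


section \<open>Moore--Penrose inverses and quadratic minimization\<close>

text \<open>Penrose's argument: \<open>A = A ** C ** A\<close> gives AB = (AC)(AB). Both factors are
  symmetric, so transposing yields AB = (AB)(AC) = AC. Likewise BA = CA, and then B = BAB = BAC =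
  CAC = C.\<close>

lemma moore_penrose_unique:
  fixes A :: "real^'n^'m"
  assumes B: "is_moore_penrose A B" and C: "is_moore_penrose A C"
  shows "B = C"
proof -
  note b = B[unfolded is_moore_penrose_def] and c = C[unfolded is_moore_penrose_def]
  have "A ** B = (A ** C) ** (A ** B)"
    by (metis c matrix_mul_assoc)
  then have "A ** B = (A ** B) ** (A ** C)"
    by (metis b c matrix_transpose_mul)
  then have AB: "A ** B = A ** C"
    by (metis b matrix_mul_assoc)
  have "B ** A = (B ** A) ** (C ** A)"
    by (metis c matrix_mul_assoc)
  then have "B ** A = (C ** A) ** (B ** A)"
    by (metis b c matrix_transpose_mul)
  then have BA: "B ** A = C ** A"
    by (metis b matrix_mul_assoc)
  show ?thesis
    by (metis AB BA b c matrix_mul_assoc)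
qed

lemma orthogonal_projection_matrix_exists:
  fixes S :: "(real^'n) set"
  assumes "subspace S"
  obtains P :: "real^'n^'n" where "transpose P = P" "\<And>x. P *v x \<in> S" "\<And>x. x \<in> S \<Longrightarrow> P *v x = x"
proof -
  obtain B where B: "B \<subseteq> S" "pairwise orthogonal B" "\<And>x. x \<in> B \<Longrightarrow> norm x = 1"
      "independent B" "span B = S"
    using orthonormal_basis_subspace[OF assms] by metis
  have fin: "finite B"
    using B(4) independent_imp_finite by blast
  \<comment> \<open>This is the sum of the rank-one projections b b^T over an orthonormal basis;
    that form makes the symmetry of the matrix visible entrywise.\<close>
  define f where "f = (\<lambda>x. \<Sum>b\<in>B. (x \<bullet> b) *\<^sub>R b)"
  have lin: "linear f"
    by (intro linearI)
      (simp_all add: f_def inner_left_distrib scaleR_left_distrib sum.distrib scaleR_sum_right)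
  have works: "matrix f *v x = f x" for x
    using matrix_vector_mul(2)[OF lin] by metis
  have fb: "f b = b" if "b \<in> B" for b
  proof -
    have "(b \<bullet> c) *\<^sub>R c = (if c = b then b else 0)" if "c \<in> B" for c
      using B(2,3) that \<open>b \<in> B\<close>
      by (auto simp: pairwise_def orthogonal_def dot_square_norm)
    then show ?thesis
      unfolding f_def using fin that by (simp cong: sum.cong)
  qed
  show ?thesis
  proof
    show "transpose (matrix f) = matrix f"
    proof -
      have "matrix f $ i $ j = (\<Sum>b\<in>B. b $ i * b $ j)" for i j
        by (simp add: matrix_def f_def inner_axis' mult.commute)
      then show ?thesis
        by (simp add: transpose_def vec_eq_iff mult.commute)
    qed
    have "f x \<in> S" for x
      unfolding f_def using assms B(1) by (auto intro!: subspace_sum subspace_scale)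
    then show "matrix f *v x \<in> S" for x
      by (simp add: works)
    show "matrix f *v x = x" if "x \<in> S" for x
    proof -
      have "x \<in> span B" using that B(5) by simp
      then have "f x = x"
        by (induction rule: span_induct_alt)
          (simp_all add: fb linear_0[OF lin] linear_add[OF lin] linear_scale[OF lin])
      then show ?thesis by (simp add: works)
    qed
  qed
qed

lemma inner_symmetric_matrix:
  fixes A :: "real^'n^'n"
  assumes "transpose A = A"
  shows "(A *v x) \<bullet> y = x \<bullet> (A *v y)"
  by (metis assms dot_lmul_matrix transpose_matrix_vector)

text \<open>
  If \<open>P\<close> is the orthogonal projection onto the kernel of the symmetric matrix \<open>Q\<close>, then \<open>Q + P\<close> is
  invertible and \<open>Q\<^sup>+ = (Q + P)\<^sup>-\<^sup>1 - P\<close>.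
\<close>

lemma symmetric_moore_penrose_exists:
  fixes Q :: "real^'n^'n"
  assumes sym: "transpose Q = Q"
  obtains B P where "is_moore_penrose Q B" "transpose P = P" "Q ** P = 0" "Q ** B + P = mat 1"
proof -
  obtain P where P: "transpose P = P" "\<And>x. Q *v (P *v x) = 0" "\<And>x. Q *v x = 0 \<Longrightarrow> P *v x = x"
  proof -
    have "subspace {x. Q *v x = 0}"
      by (auto simp: subspace_def algebra_simps matrix_vector_right_distrib)
    from orthogonal_projection_matrix_exists[OF this] that show ?thesis by auto
  qed
  have QP: "Q ** P = 0"
    by (simp add: matrix_eq P flip: matrix_vector_mul_assoc)
  have PQ: "P ** Q = 0"
  proof -
    have "transpose (Q ** P) = P ** Q"
      by (simp add: matrix_transpose_mul sym P)
    then show ?thesis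
      by (simp add: QP transpose_def vec_eq_iff)
  qed
  have PP: "P ** P = P"
    by (simp add: matrix_eq P flip: matrix_vector_mul_assoc)
  \<comment> \<open>Applying \<open>P\<close> removes the \<open>Q\<close> part and leaves Px = 0.
    Then Qx = 0, so \<open>x\<close> lies in the kernel, where \<open>P\<close> is the identity, and
    x = Px = 0.\<close>
  have "x = 0" if "(Q + P) *v x = 0" for x
  proof -
    have s: "Q *v x + P *v x = 0"
      using that by (simp add: matrix_vector_mult_add_rdistrib)
    have "P *v (Q *v x + P *v x) = P *v x"
      by (simp add: matrix_vector_right_distrib matrix_vector_mul_assoc PQ PP)
    then have "P *v x = 0" using s by simp
    then have "Q *v x = 0" using s by simp
    then show ?thesis using P(3) \<open>P *v x = 0\<close> by metis
  qed
  then obtain M where M: "M ** (Q + P) = mat 1"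
    by (metis matrix_left_invertible_ker)
  then have M': "(Q + P) ** M = mat 1"
    by (simp add: matrix_left_right_inverse)
  \<comment> \<open>A left inverse and a right inverse of the same matrix coincide, so the inverse
    of the symmetric matrix Q + P is symmetric.\<close>
  have "transpose M ** (Q + P) = mat 1"
  proof -
    have "transpose (Q + P) = Q + P"
      using sym P(1) by (simp add: transpose_def vec_eq_iff)
    then show ?thesis
      using M' by (metis matrix_transpose_mul transpose_mat)
  qed
  then have MT: "transpose M = M"
    by (metis M M' matrix_mul_assoc matrix_mul_lid matrix_mul_rid)
  have MP: "M ** P = P"
  proof -
    have "(Q + P) ** P = P"
      by (simp add: matrix_mult.add_left QP PP)
    then show ?thesis
      by (metis M matrix_mul_assoc matrix_mul_lid)
  qed
  have PM: "P ** M = P"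
    by (metis MP MT P(1) matrix_transpose_mul)
  define B where "B = M - P"
  have "Q ** M + P = mat 1"
    using M' PM by (simp add: matrix_mult.add_left)
  then have QB: "Q ** B + P = mat 1"
    by (simp add: B_def matrix_mult.diff_right QP)
  have "M ** Q + P = mat 1"
    using M MP by (simp add: matrix_mult.add_right)
  then have BQ: "B ** Q + P = mat 1"
    by (simp add: B_def matrix_mult.diff_left PQ)
  \<comment> \<open>Both products equal the symmetric projection 1 - P, so the four Penrose
    equations reduce to PQ = 0 and PB = 0.\<close>
  have QB': "Q ** B = mat 1 - P" and BQ': "B ** Q = mat 1 - P"
    using QB BQ by (simp_all add: eq_diff_eq)
  have "P ** B = 0"
    by (simp add: B_def matrix_mult.diff_right PM PP)
  moreover have "transpose (mat 1 - P) = mat 1 - P"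
    using P(1) by (simp add: transpose_def vec_eq_iff mat_def)
  ultimately have "is_moore_penrose Q B"
    by (simp add: is_moore_penrose_def QB' BQ' matrix_mult.diff_left PQ)
  then show ?thesis
    using that P(1) QP QB by blast
qed

lemma moore_penrose_eq:
  assumes "is_moore_penrose A B"
  shows "moore_penrose A = B"
  unfolding moore_penrose_def using assms moore_penrose_unique by blast

lemma is_moore_penrose_moore_penrose:
  fixes Q :: "real^'n^'n"
  assumes "transpose Q = Q"
  shows "is_moore_penrose Q (moore_penrose Q)"
  by (metis assms symmetric_moore_penrose_exists moore_penrose_eq)

text \<open>The range of a symmetric matrix is the orthogonal complement of its kernel: in b = Q(Bb)
  + Pb the second term vanishes, because \<open>b\<close> is orthogonal to everything of the form
  Pv.\<close>

lemma mem_range_symmetric_matrixI: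
  fixes Q :: "real^'n^'n"
  assumes "transpose Q = Q" and orth: "\<And>v. Q *v v = 0 \<Longrightarrow> b \<bullet> v = 0"
  shows "b \<in> range (\<lambda>v. Q *v v)"
proof -
  obtain B P where P: "transpose P = P" "Q ** P = 0" "Q ** B + P = mat 1"
    using symmetric_moore_penrose_exists[OF assms(1)] by metis
  have ker: "Q *v (P *v v) = 0" for v
    by (simp add: matrix_vector_mul_assoc P)
  have "(P *v b) \<bullet> v = 0" for v
    using orth[OF ker] by (simp add: inner_symmetric_matrix P)
  then have "P *v b = 0"
    by (metis inner_eq_zero_iff)
  moreover have "b = Q *v (B *v b) + P *v b"
    using P(3) by (metis matrix_vector_mul_assoc matrix_vector_mul_lid matrix_vector_mult_add_rdistrib)
  ultimately show ?thesis by simp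
qed

text \<open>For \<open>b\<close> in the range, Q Q^+ b = b, so - Q^+ b is a particular solution; the
  matrix I - Q^+ Q maps into the kernel of \<open>Q\<close>.\<close>

lemma solutions_moore_penrose:
  fixes Q :: "real^'n^'n"
  assumes sym: "transpose Q = Q" and b: "b \<in> range (\<lambda>v. Q *v v)"
  shows "{\<theta>. Q *v \<theta> = - b} = {- (moore_penrose Q *v b) - (mat 1 - moore_penrose Q ** Q) *v y | y. True}"
    (is "_ = {?s y | y. True}")
proof -
  let ?B = "moore_penrose Q"
  have QBQ: "Q *v (?B *v (Q *v v)) = Q *v v" for v
    using is_moore_penrose_moore_penrose[OF sym]
    by (simp add: is_moore_penrose_def matrix_vector_mul_assoc matrix_mul_assoc)
  have s: "?s y = - (?B *v b) - y + ?B *v (Q *v y)" for y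
    by (simp add: matrix_vector_mult_diff_rdistrib flip: matrix_vector_mul_assoc)
  have neg: "A *v - v = - (A *v v)" for A :: "real^'n^'n" and v
    by (metis diff_0 matrix_vector_mult_0_right matrix_vector_mult_diff_distrib)
  have "Q *v ?s y = - b" for y
    using b QBQ unfolding s
    by (auto simp: matrix_vector_right_distrib matrix_vector_mult_diff_distrib neg)
  \<comment> \<open>Every solution is reached with its own negative as parameter, since then Q^+ Q y
    = Q^+ b cancels the leading term.\<close>
  moreover have "\<theta> = ?s (- \<theta>)" if "Q *v \<theta> = - b" for \<theta>
    unfolding s using that by (simp add: neg)
  ultimately show ?thesis by blast
qed

section \<open>Minimizers of quadratic functions\<close>

lemma linear_term_zero_of_nonneg:
  fixes a b :: real
  assumes "\<And>s. 0 \<le> a * s\<^sup>2 + b * s"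
  shows "b = 0"
proof (rule ccontr)
  assume "b \<noteq> 0"
  \<comment> \<open>The denominator 1 + |a| is positive and exceeds \<open>a\<close>, so one choice
    of argument gives a negative value whatever the sign of \<open>a\<close>.\<close>
  let ?s = "- b / (1 + \<bar>a\<bar>)"
  have "a * ?s\<^sup>2 + b * ?s = b\<^sup>2 * (a - (1 + \<bar>a\<bar>)) / (1 + \<bar>a\<bar>)\<^sup>2"
    by (simp add: divide_simps power2_eq_square) (simp add: algebra_simps)
  also have "\<dots> < 0"
    using \<open>b \<noteq> 0\<close> by (intro divide_neg_pos mult_pos_neg) auto
  finally show False
    using assms[of ?s] by simp
qed

text \<open>A minimizer is tested in the direction of its residual v = Q theta + b: the increment
  has linear coefficient 2a |v|^2, which must vanish. Conversely, at a solution the increment is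
  \<open>a\<close> times the quadratic form of the displacement, which is nonnegative.\<close>

lemma argmin_set_quadratic:
  fixes Q :: "real^'n^'n"
  assumes "psd_matrix Q" "0 < a"
    and f: "\<And>\<theta>. f \<theta> = a * (\<theta> \<bullet> (Q *v \<theta>) + 2 * (b \<bullet> \<theta>)) + c"
  shows "argmin_set f = {\<theta>. Q *v \<theta> = - b}"
proof -
  have sym: "transpose Q = Q" and psd: "0 \<le> v \<bullet> (Q *v v)" for v
    using assms(1) by (auto simp: psd_matrix_def)
  have expand: "f (\<theta> + s *\<^sub>R v) - f \<theta>
      = a * (v \<bullet> (Q *v v)) * s\<^sup>2 + 2 * a * ((Q *v \<theta> + b) \<bullet> v) * s" for \<theta> v s
    unfolding f using inner_symmetric_matrix[OF sym, of \<theta> v]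
    by (simp add: matrix_vector_right_distrib matrix_vector_mult_scaleR inner_simps
        inner_commute algebra_simps power2_eq_square)
  have "Q *v \<theta> = - b" if min: "\<And>\<theta>'. f \<theta> \<le> f \<theta>'" for \<theta>
  proof -
    let ?v = "Q *v \<theta> + b"
    have "0 \<le> a * (?v \<bullet> (Q *v ?v)) * s\<^sup>2 + 2 * a * (?v \<bullet> ?v) * s" for s
      using min[of "\<theta> + s *\<^sub>R ?v"] expand[of \<theta> s ?v] by linarith
    then have "2 * a * (?v \<bullet> ?v) = 0"
      by (rule linear_term_zero_of_nonneg)
    then show ?thesis
      using \<open>0 < a\<close> by (simp add: eq_neg_iff_add_eq_0)
  qed
  moreover have "f \<theta> \<le> f \<theta>'" if "Q *v \<theta> = - b" for \<theta> \<theta>'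
  proof -
    have "f \<theta>' - f \<theta> = a * ((\<theta>' - \<theta>) \<bullet> (Q *v (\<theta>' - \<theta>)))"
      using expand[of \<theta> 1 "\<theta>' - \<theta>"] that by simp
    moreover have "0 \<le> a * ((\<theta>' - \<theta>) \<bullet> (Q *v (\<theta>' - \<theta>)))"
      using psd[of "\<theta>' - \<theta>"] \<open>0 < a\<close> by simp
    ultimately show ?thesis
      by linarith
  qed
  ultimately show ?thesis
    by (auto simp: argmin_set_def is_arg_min_def not_less)
qed

lemma argmin_set_quadratic_nonempty:
  fixes Q :: "real^'n^'n"
  assumes "argmin_set f = {\<theta>. Q *v \<theta> = - b}"
  shows "argmin_set f \<noteq> {} \<longleftrightarrow> b \<in> range (\<lambda>v. Q *v v)"
proof -
  have "Q *v - v = - (Q *v v)" for v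
    by (metis diff_0 matrix_vector_mult_0_right matrix_vector_mult_diff_distrib)
  then have "Q *v v = - b \<longleftrightarrow> b = Q *v - v" for v
    by auto
  then show ?thesis
    unfolding assms by (metis (mono_tags, lifting) empty_Collect_eq image_iff minus_minus UNIV_I)
qed


section \<open>Derivatives along tangent vectors\<close>

text \<open>A relational counterpart of \<open>tangent_deriv\<close>, for which the differentiation
  rules need no existence or uniqueness argument. It holds vacuously when \<open>v\<close> is not
  tangent, so uniqueness asks for a curve with velocity \<open>v\<close>.\<close>

definition has_tangent_deriv ::
    "'a::real_normed_vector set \<Rightarrow> ('a \<Rightarrow> real) \<Rightarrow> 'a \<Rightarrow> 'a \<Rightarrow> real \<Rightarrow> bool" where
  "has_tangent_deriv M f x v l \<longleftrightarrow>
     (\<forall>c. curve_in M x v c \<longrightarrow> ((\<lambda>t. f (c t)) has_real_derivative l) (at 0))"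

lemma has_tangent_deriv_unique:
  assumes "v \<in> tangent_space M x" "has_tangent_deriv M f x v l" "has_tangent_deriv M f x v l'"
  shows "l = l'"
proof -
  obtain c where "curve_in M x v c"
    using assms(1) by (auto simp: tangent_space_def)
  then have "((\<lambda>t. f (c t)) has_real_derivative l) (at 0)" "((\<lambda>t. f (c t)) has_real_derivative l') (at 0)"
    using assms(2,3) by (auto simp: has_tangent_deriv_def)
  then show ?thesis
    by (rule DERIV_unique)
qed

lemma tangent_deriv_eqI:
  assumes "v \<in> tangent_space M x" "has_tangent_deriv M f x v l"
  shows "tangent_deriv M f x v = l"
proof -
  have "tangent_deriv M f x v = (THE l. has_tangent_deriv M f x v l)"
    by (simp add: tangent_deriv_def has_tangent_deriv_def)
  also have "\<dots> = l"
    using assms has_tangent_deriv_unique by (intro the_equality)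
  finally show ?thesis .
qed

lemma curve_in_eventually:
  assumes "curve_in M x v c"
  shows "eventually (\<lambda>t. c t \<in> M) (nhds 0)"
proof -
  obtain e where "e > 0" "c ` {-e<..<e} \<subseteq> M"
    using assms by (auto simp: curve_in_def)
  then show ?thesis
    by (intro eventually_nhds_in_open[of "{-e<..<e}", THEN eventually_mono]) auto
qed

text \<open>Admissible curves stay in \<open>M\<close> near time 0, so only values on
  \<open>M\<close> matter. This permits rewriting logarithms and swapping kernel arguments where the
  formulas hold on the manifold alone.\<close>

lemma has_tangent_deriv_cong:
  assumes "\<And>y. y \<in> M \<Longrightarrow> f y = g y"
  shows "has_tangent_deriv M f x v l \<longleftrightarrow> has_tangent_deriv M g x v l"
proof -
  have "((\<lambda>t. f (c t)) has_real_derivative l) (at 0) \<longleftrightarrow> ((\<lambda>t. g (c t)) has_real_derivative l) (at 0)"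
    if "curve_in M x v c" for c
  proof -
    have "eventually (\<lambda>t. f (c t) = g (c t)) (nhds 0)"
      using curve_in_eventually[OF that] by eventually_elim (rule assms)
    then show ?thesis
      by (rule DERIV_cong_ev[OF refl _ refl])
  qed
  then show ?thesis
    by (auto simp: has_tangent_deriv_def)
qed

lemma tangent_deriv_cong:
  assumes "\<And>y. y \<in> M \<Longrightarrow> f y = g y"
  shows "tangent_deriv M f x v = tangent_deriv M g x v"
proof -
  have "tangent_deriv M f x v = (THE l. has_tangent_deriv M f x v l)" for f
    by (simp add: tangent_deriv_def has_tangent_deriv_def)
  then show ?thesis
    using has_tangent_deriv_cong[of M f g, OF assms] by simp
qed

text \<open>The chain rule for the ambient extension \<open>F\<close> along the curve; near time 0
  the curve lies in both \<open>M\<close> and \<open>U\<close>, where \<open>F\<close> and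
  \<open>f\<close> agree.\<close>

lemma has_tangent_deriv_extension:
  assumes U: "open U" "x \<in> U" and F: "\<And>y. y \<in> M \<inter> U \<Longrightarrow> F y = f y"
    and F': "(F has_derivative F') (at x)"
  shows "has_tangent_deriv M f x v (F' v)"
  unfolding has_tangent_deriv_def
proof (intro allI impI)
  fix c assume c: "curve_in M x v c"
  then have c0: "c 0 = x" and der: "(c has_vector_derivative v) (at 0)"
    by (auto simp: curve_in_def)
  have "((F \<circ> c) has_vector_derivative F' v) (at 0)"
    by (metis F' c0 der has_derivative_at_withinI vector_derivative_diff_chain_within)
  then have *: "((\<lambda>t. F (c t)) has_real_derivative F' v) (at 0)"
    by (simp add: has_real_derivative_iff_has_vector_derivative o_def)
  have "(c \<longlongrightarrow> x) (at 0)"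
    using has_vector_derivative_continuous[OF der] c0 by (simp add: continuous_at)
  then have "eventually (\<lambda>t. c t \<in> U) (nhds 0)"
    using U c0 by (auto simp: eventually_nhds_conv_at intro: topological_tendstoD)
  with curve_in_eventually[OF c] have "eventually (\<lambda>t. F (c t) = f (c t)) (nhds 0)"
    by eventually_elim (simp add: F)
  with * show "((\<lambda>t. f (c t)) has_real_derivative F' v) (at 0)"
    using DERIV_cong_ev[OF refl _ refl, of "\<lambda>t. F (c t)" "\<lambda>t. f (c t)"] by simp
qed

lemma has_tangent_deriv_const: "has_tangent_deriv M (\<lambda>_. c) x v 0"
  by (simp add: has_tangent_deriv_def)

lemma has_tangent_deriv_add:
  assumes "has_tangent_deriv M f x v k" "has_tangent_deriv M g x v l"
  shows "has_tangent_deriv M (\<lambda>y. f y + g y) x v (k + l)"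
  using assms unfolding has_tangent_deriv_def by (intro allI impI DERIV_add) simp_all

lemma has_tangent_deriv_cmult:
  assumes "has_tangent_deriv M f x v l"
  shows "has_tangent_deriv M (\<lambda>y. c * f y) x v (c * l)"
  using assms unfolding has_tangent_deriv_def by (intro allI impI DERIV_cmult) simp_all

lemma has_tangent_deriv_sum:
  assumes "\<And>i. i \<in> I \<Longrightarrow> has_tangent_deriv M (f i) x v (l i)"
  shows "has_tangent_deriv M (\<lambda>y. \<Sum>i\<in>I. f i y) x v (\<Sum>i\<in>I. l i)"
  using assms unfolding has_tangent_deriv_def by (intro allI impI DERIV_sum) simp_all

lemma has_tangent_deriv_ln:
  assumes "has_tangent_deriv M f x v l" "0 < f x"
  shows "has_tangent_deriv M (\<lambda>y. ln (f y)) x v (l / f x)"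
  unfolding has_tangent_deriv_def
proof (intro allI impI)
  fix c assume c: "curve_in M x v c"
  then have c0: "c 0 = x"
    by (simp add: curve_in_def)
  have "((\<lambda>t. f (c t)) has_real_derivative l) (at 0)"
    using assms(1) c by (simp add: has_tangent_deriv_def)
  then have "((\<lambda>t. ln (f (c t))) has_real_derivative 1 / f (c 0) * l) (at 0)"
    using assms(2) c0 by (intro DERIV_chain2[OF DERIV_ln_divide]) auto
  then show "((\<lambda>t. ln (f (c t))) has_real_derivative l / f x) (at 0)"
    by (simp add: c0)
qed

lemma C1_on_has_tangent_deriv:
  assumes "C1_on M f" "x \<in> M"
  obtains l where "has_tangent_deriv M f x v l"
proof -
  from assms(1)[unfolded C1_on_def, THEN bspec, OF assms(2)]
  obtain U F F' where "open U" "x \<in> U" "\<forall>y\<in>M \<inter> U. F y = f y"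
      "\<forall>y\<in>U. (F has_derivative blinfun_apply (F' y)) (at y)"
    by blast
  then have "has_tangent_deriv M f x v (blinfun_apply (F' x) v)"
    by (intro has_tangent_deriv_extension[where U = U and F = F]) auto
  then show ?thesis
    by (rule that)
qed

lemma C1_on_component:
  fixes f :: "'a::real_normed_vector \<Rightarrow> real^'s"
  assumes "C1_on M f"
  shows "C1_on M (\<lambda>y. f y $ k)"
  unfolding C1_on_def
proof
  fix x assume "x \<in> M"
  then obtain U F F' where U: "open U" "x \<in> U" "\<forall>y\<in>M \<inter> U. F y = f y"
      and F: "\<forall>y\<in>U. (F has_derivative blinfun_apply (F' y)) (at y)" "continuous_on U F'"
    using assms unfolding C1_on_def by metis
  define p where "p = Blinfun (\<lambda>z::real^'s. z $ k)"
  have p: "blinfun_apply p = (\<lambda>z. z $ k)"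
    unfolding p_def by (rule bounded_linear_Blinfun_apply) (rule bounded_linear_vec_nth)
  have cont: "continuous_on U (\<lambda>y. p o\<^sub>L F' y)"
    using F(2) by (intro continuous_intros)
  have "blinfun_apply (p o\<^sub>L F' y) = (\<lambda>z. blinfun_apply (F' y) z $ k)" for y
    by (simp add: fun_eq_iff p)
  then have der: "((\<lambda>y. F y $ k) has_derivative blinfun_apply (p o\<^sub>L F' y)) (at y)" if "y \<in> U" for y
    using bounded_linear.has_derivative[OF bounded_linear_vec_nth, of F _ "at y" k] F(1) that by metis
  show "\<exists>U G G'. open U \<and> x \<in> U \<and> (\<forall>y\<in>M \<inter> U. G y = f y $ k) \<and>
      (\<forall>y\<in>U. (G has_derivative blinfun_apply (G' y)) (at y)) \<and> continuous_on U G'"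
    by (rule exI[of _ U], rule exI[of _ "\<lambda>y. F y $ k"], rule exI[of _ "\<lambda>y. p o\<^sub>L F' y"])
      (intro conjI ballI, fact U(1), fact U(2), simp add: U(3), erule der, rule cont)
qed

lemma C11_on_has_tangent_deriv:
  assumes "C11_on M \<kappa>" "x \<in> M" "y \<in> M"
  obtains l where "has_tangent_deriv M (\<lambda>u. \<kappa> u y) x v l"
proof -
  from assms(1)[unfolded C11_on_def, THEN bspec, OF assms(2), THEN bspec, OF assms(3)]
  show ?thesis
  proof (elim exE conjE)
    fix U V K K1 K2 K12
    assume "open U" "x \<in> U" "y \<in> V" "\<forall>u\<in>M \<inter> U. \<forall>w\<in>M \<inter> V. K u w = \<kappa> u w"
      "\<forall>u\<in>U. \<forall>w\<in>V.
         ((\<lambda>u'. K u' w) has_derivative blinfun_apply (K1 u w)) (at u) \<and>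
         ((\<lambda>w'. K u w') has_derivative blinfun_apply (K2 u w)) (at w) \<and>
         ((\<lambda>w'. K1 u w') has_derivative blinfun_apply (K12 u w)) (at w)"
    then have "has_tangent_deriv M (\<lambda>u. \<kappa> u y) x v (blinfun_apply (K1 x y) v)"
      using assms(3) by (intro has_tangent_deriv_extension[where U = U and F = "\<lambda>u. K u y"]) auto
    then show ?thesis
      by (rule that)
  qed
qed


section \<open>Killing fields on the Grassmann manifold\<close>

text \<open>
  If \<open>J\<close> is skew-symmetric with \<open>J\<^sup>3 = - J\<close>, the exponential series of \<open>t J\<close> collapses to
  Rodrigues' formula.
\<close>

definition rodrigues :: "real^'n^'n \<Rightarrow> real \<Rightarrow> real^'n^'n" where
  "rodrigues J t = mat 1 + sin t *\<^sub>R J + (1 - cos t) *\<^sub>R (J ** J)"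

lemma transpose_linear_simps:
  fixes A B :: "real^'n^'m"
  shows "transpose (A + B) = transpose A + transpose B"
    and "transpose (A - B) = transpose A - transpose B"
    and "transpose (c *\<^sub>R A) = c *\<^sub>R transpose A"
  by (simp_all add: transpose_def vec_eq_iff)

text \<open>With s = sin t and c = 1 - cos t the odd powers of \<open>J\<close> cancel, and J^4 = -
  J^2 leaves the coefficient 2c - c^2 - s^2 of J^2. It is zero by sin^2 + cos^2 = 1.\<close>

lemma rodrigues_orthogonal:
  assumes J: "transpose J = - J" "J ** J ** J = - J"
  shows "transpose (rodrigues J t) = rodrigues J (- t)"
    and "rodrigues J (- t) ** rodrigues J t = mat 1"
proof -
  show "transpose (rodrigues J t) = rodrigues J (- t)"
    by (simp add: rodrigues_def transpose_linear_simps matrix_transpose_mul J matrix_mult.minus_left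
        matrix_mult.minus_right)
  define c where "c = 1 - cos t"
  define s where "s = sin t"
  have cs: "2 * c - c\<^sup>2 - s\<^sup>2 = 0"
    using sin_cos_squared_add[of t] by (simp add: c_def s_def power2_eq_square algebra_simps)
  have J3: "J ** (J ** J) = - J"
    using J by (simp add: matrix_mul_assoc)
  have J4: "J ** J ** (J ** J) = - (J ** J)"
    by (metis J(2) matrix_mul_assoc matrix_mult.minus_left)
  have "rodrigues J (- t) ** rodrigues J t = mat 1 + (2 * c - c\<^sup>2 - s\<^sup>2) *\<^sub>R (J ** J)"
    by (simp add: rodrigues_def c_def[symmetric] s_def[symmetric] matrix_mult.add_left
        matrix_mult.add_right matrix_mult.diff_left matrix_mult.scaleR_left matrix_mult.minus_left
        matrix_mult.scaleR_right J J3 J4 algebra_simps power2_eq_square)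
      (simp add: vec_eq_iff)
  then show "rodrigues J (- t) ** rodrigues J t = mat 1"
    using cs by simp
qed

lemma conjugate_in_grassmann:
  fixes X R :: "real^'n^'n"
  assumes X: "X \<in> grassmann r" and R: "transpose R ** R = mat 1"
  shows "R ** X ** transpose R \<in> grassmann r"
proof -
  have sym: "transpose X = X" and idem: "X ** X = X" and tr: "trace X = real r"
    using X by (auto simp: grassmann_def)
  have "(R ** X ** transpose R) ** (R ** X ** transpose R)
      = R ** X ** (transpose R ** R) ** X ** transpose R"
    by (simp only: matrix_mul_assoc)
  also have "\<dots> = R ** (X ** X) ** transpose R"
    by (simp add: R matrix_mul_assoc)
  finally have "(R ** X ** transpose R) ** (R ** X ** transpose R) = R ** X ** transpose R"
    by (simp add: idem)
  moreover have "trace (R ** X ** transpose R) = trace (transpose R ** R ** X)"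
    by (metis trace_mul_sym matrix_mul_assoc)
  ultimately show ?thesis
    by (simp add: grassmann_def matrix_transpose_mul sym tr R matrix_mul_assoc)
qed

lemma rodrigues_has_vector_derivative:
  "((\<lambda>t. rodrigues J (s * t)) has_vector_derivative
     (s * cos (s * t)) *\<^sub>R J + (s * sin (s * t)) *\<^sub>R (J ** J)) (at t)"
proof -
  have "((\<lambda>t. sin (s * t)) has_real_derivative s * cos (s * t)) (at t)"
    "((\<lambda>t. 1 - cos (s * t)) has_real_derivative s * sin (s * t)) (at t)"
    by (auto intro!: derivative_eq_intros)
  note * = this[THEN has_vector_derivative_scaleR, OF has_vector_derivative_const]
  show ?thesis
    using has_vector_derivative_add[OF has_vector_derivative_add[OF has_vector_derivative_const *(1)] *(2)]
    by (simp add: rodrigues_def)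
qed

text \<open>The curve conjugates \<open>X\<close> by the rotation with angle st. The factor
  \<open>s\<close> is kept apart from \<open>J\<close> because the cubic relation does not survive
  scaling; it changes the speed of the curve instead.\<close>

lemma commutator_in_tangent_space:
  fixes X J :: "real^'n^'n"
  assumes X: "X \<in> grassmann r" and J: "transpose J = - J" "J ** J ** J = - J"
  shows "(s *\<^sub>R J) ** X - X ** (s *\<^sub>R J) \<in> tangent_space (grassmann r) X"
proof -
  let ?R = "\<lambda>t. rodrigues J (s * t)"
  define R' where "R' = (\<lambda>t. (s * cos (s * t)) *\<^sub>R J + (s * sin (s * t)) *\<^sub>R (J ** J))"
  \<comment> \<open>The transposed rotation is written as a rotation with parameter
    \<open>- s\<close>, so one derivative formula serves both factors.\<close>
  define c where "c = (\<lambda>t. ?R t ** X ** rodrigues J ((- s) * t))"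
  define S' where "S' = (\<lambda>t. (- s * cos (- s * t)) *\<^sub>R J + (- s * sin (- s * t)) *\<^sub>R (J ** J))"
  define c' where "c' = (\<lambda>t. ?R t ** X ** S' t + R' t ** X ** rodrigues J ((- s) * t))"
  have R': "(?R has_vector_derivative R' t) (at t)" for t
    unfolding R'_def by (rule rodrigues_has_vector_derivative)
  have S': "((\<lambda>t. rodrigues J ((- s) * t)) has_vector_derivative S' t) (at t)" for t
    unfolding S'_def by (rule rodrigues_has_vector_derivative)
  have "((\<lambda>t. ?R t ** X) has_vector_derivative ?R t ** 0 + R' t ** X) (at t)" for t
    by (rule matrix_mult.has_vector_derivative[OF R' has_vector_derivative_const])
  then have RX: "((\<lambda>t. ?R t ** X) has_vector_derivative R' t ** X) (at t)" for t
    by (simp add: matrix_mult.zero_right)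
  have c': "(c has_vector_derivative c' t) (at t)" for t
    unfolding c_def c'_def by (rule matrix_mult.has_vector_derivative[OF RX S'])
  have "continuous_on UNIV c'"
    unfolding c'_def R'_def S'_def rodrigues_def
    by (intro continuous_intros matrix_mult.continuous_on)
  then have "c C1_differentiable_on {-1<..<1}"
    unfolding C1_differentiable_on_def using c' continuous_on_subset by blast
  moreover have "c t \<in> grassmann r" for t
    using conjugate_in_grassmann[OF X, of "?R t"] rodrigues_orthogonal[OF J, of "s * t"]
    by (simp add: c_def)
  moreover have "c 0 = X"
    by (simp add: c_def rodrigues_def)
  moreover have "c' 0 = (s *\<^sub>R J) ** X - X ** (s *\<^sub>R J)"
    by (simp add: c'_def R'_def S'_def rodrigues_def matrix_mult.minus_right)
  ultimately have "curve_in (grassmann r) X ((s *\<^sub>R J) ** X - X ** (s *\<^sub>R J)) c"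
    unfolding curve_in_def using c'[of 0] by (intro conjI exI[of _ 1]) auto
  then show ?thesis
    by (auto simp: tangent_space_def)
qed

section \<open>Matrix units and Frobenius products\<close>

lemma E_unit_mult_left: "(E_unit i j ** X) $ a $ b = (if a = i then X $ j $ b else 0)"
proof -
  have "(E_unit i j ** X) $ a $ b = (\<Sum>k\<in>UNIV. if k = j then if a = i then X $ j $ b else 0 else 0)"
    unfolding E_unit_def matrix_matrix_mult_def by (simp only: vec_lambda_beta, intro sum.cong) auto
  then show ?thesis by simp
qed

lemma E_unit_mult_right: "(X ** E_unit i j) $ a $ b = (if b = j then X $ a $ i else 0)"
proof -
  have "(X ** E_unit i j) $ a $ b = (\<Sum>k\<in>UNIV. if k = i then if b = j then X $ a $ i else 0 else 0)"
    unfolding E_unit_def matrix_matrix_mult_def by (simp only: vec_lambda_beta, intro sum.cong) auto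
  then show ?thesis by simp
qed

lemma E_unit_mult: "E_unit i j ** E_unit k l = (if j = k then E_unit i l else 0)"
  by (auto simp: vec_eq_iff E_unit_mult_left) (auto simp: E_unit_def)

lemma transpose_E_unit: "transpose (E_unit i j) = E_unit j i"
  by (simp add: transpose_def E_unit_def conj_commute)

text \<open>The matrix J = E_ij - E_ji satisfies J^3 = - J, also for i = j, where it is zero. The
  normalization sqrt 2 / 2 is the scalar \<open>s\<close> of the commutator lemma.\<close>

lemma E_skew_tangent:
  fixes X :: "real^'n^'n"
  assumes "X \<in> grassmann r"
  shows "E_skew i j ** X - X ** E_skew i j \<in> tangent_space (grassmann r) X"
proof -
  let ?J = "E_unit i j - E_unit j i :: real^'n^'n"
  have "transpose ?J = - ?J"
    by (simp add: transpose_linear_simps transpose_E_unit)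
  moreover have "?J ** ?J ** ?J = - ?J"
    by (cases "i = j")
      (simp_all add: matrix_mult.diff_left matrix_mult.diff_right E_unit_mult matrix_mult.zero_left matrix_mult.minus_left)
  ultimately show ?thesis
    unfolding E_skew_def using commutator_in_tangent_space[OF assms] by blast
qed

lemma frob_eq_inner: "frob A B = A \<bullet> B"
proof -
  have "frob A B = (\<Sum>i\<in>UNIV. \<Sum>k\<in>UNIV. A $ k $ i * B $ k $ i)"
    by (simp add: frob_def trace_def transpose_def matrix_matrix_mult_def)
  also have "\<dots> = (\<Sum>k\<in>UNIV. \<Sum>i\<in>UNIV. A $ k $ i * B $ k $ i)"
    by (rule sum.swap)
  also have "\<dots> = A \<bullet> B"
    by (simp add: inner_vec_def)
  finally show ?thesis .
qed

lemma frob_E_unit_mult: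
  fixes G X :: "real^'n^'n"
  shows "frob G (E_unit i j ** X) = (G ** transpose X) $ i $ j"
    and "frob G (X ** E_unit i j) = (transpose X ** G) $ i $ j"
proof -
  have "frob G (E_unit i j ** X) = (\<Sum>a\<in>UNIV. if a = i then \<Sum>b\<in>UNIV. G $ a $ b * X $ j $ b else 0)"
    unfolding frob_eq_inner inner_vec_def by (intro sum.cong) (auto simp: E_unit_mult_left)
  then show "frob G (E_unit i j ** X) = (G ** transpose X) $ i $ j"
    by (simp add: matrix_matrix_mult_def transpose_def)
  have "frob G (X ** E_unit i j) = (\<Sum>a\<in>UNIV. \<Sum>b\<in>UNIV. if b = j then G $ a $ b * X $ a $ i else 0)"
    unfolding frob_eq_inner inner_vec_def by (intro sum.cong) (auto simp: E_unit_mult_right)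
  then show "frob G (X ** E_unit i j) = (transpose X ** G) $ i $ j"
    by (simp add: matrix_matrix_mult_def transpose_def mult.commute)
qed

text \<open>Pairing with matrix units reads off entries of GX and XG. Symmetry of \<open>X\<close>
  gives XG = (G^T X)^T, so the four terms combine to the difference of (G + G^T) X and its transpose
  at (i, j). The two halvings in \<open>sym_part\<close> and \<open>skew_part\<close> turn sqrt 2 /
  2 into 2 sqrt 2.\<close>

lemma frob_killing:
  fixes G X :: "real^'n^'n"
  assumes "transpose X = X"
  shows "frob G (E_skew i j ** X - X ** E_skew i j) = 2 * sqrt 2 * skew_part (sym_part G ** X) $ i $ j"
proof -
  have "X ** G = transpose (transpose G ** X)"
    by (simp add: matrix_transpose_mul assms)
  then have "(X ** G) $ k $ l = (transpose G ** X) $ l $ k" for k l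
    by (simp add: transpose_def)
  then have "frob G (E_skew i j ** X - X ** E_skew i j) =
      sqrt 2 / 2 * ((G ** X) $ i $ j - (G ** X) $ j $ i - (transpose G ** X) $ j $ i + (transpose G ** X) $ i $ j)"
    using assms frob_E_unit_mult[where G = G and X = X]
    by (simp add: E_skew_def frob_eq_inner matrix_mult.scaleR_left matrix_mult.scaleR_right
        matrix_mult.diff_left matrix_mult.diff_right inner_diff_right algebra_simps)
  also have "\<dots> = 2 * sqrt 2 * skew_part (sym_part G ** X) $ i $ j"
    by (simp add: skew_part_def sym_part_def matrix_mult.scaleR_left matrix_mult.add_left
        transpose_linear_simps field_simps transpose_def[of "_ ** _"])
  finally show ?thesis .
qed

lemma transpose_skew_part: "transpose (skew_part A) = - skew_part A"
  unfolding skew_part_def transpose_linear_simps transpose_transpose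
  by (metis minus_diff_eq scaleR_minus_right)

text \<open>The diagonals are zero, and (i, j) and (j, i) contribute equally because both signs
  flip.\<close>

lemma inner_skew_upper:
  fixes A B :: "'n::{finite,linorder} sqmat"
  assumes "transpose A = - A" "transpose B = - B"
  shows "A \<bullet> B = 2 * (\<Sum>(i, j)\<in>{(i, j). i < j}. A $ i $ j * B $ i $ j)"
proof -
  let ?f = "\<lambda>(i, j). A $ i $ j * B $ i $ j" and ?L = "{(i, j). i < j} :: ('n \<times> 'n) set"
  have neg: "A $ j $ i = - A $ i $ j" "B $ j $ i = - B $ i $ j" for i j
  proof -
    have "transpose A $ i $ j = - A $ i $ j" "transpose B $ i $ j = - B $ i $ j"
      using assms by simp_all
    then show "A $ j $ i = - A $ i $ j" "B $ j $ i = - B $ i $ j"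
      by (simp_all add: transpose_def)
  qed
  have diag: "A $ i $ i = 0" for i
    using neg(1)[of i i] by simp
  have "A \<bullet> B = (\<Sum>p\<in>UNIV. ?f p)"
    by (simp add: inner_vec_def sum.cartesian_product)
  also have "\<dots> = (\<Sum>p\<in>?L \<union> prod.swap ` ?L. ?f p)"
    by (intro sum.mono_neutral_right) (auto simp: diag image_iff not_less_iff_gr_or_eq)
  also have "\<dots> = (\<Sum>p\<in>?L. ?f p) + (\<Sum>p\<in>prod.swap ` ?L. ?f p)"
    by (intro sum.union_disjoint) auto
  also have "(\<Sum>p\<in>prod.swap ` ?L. ?f p) = (\<Sum>p\<in>?L. ?f p)"
  proof -
    have "?f (prod.swap p) = ?f p" for p
      using neg[where i = "fst p" and j = "snd p"] by (simp add: case_prod_unfold)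
    then show ?thesis
      by (subst sum.reindex) (simp_all only: o_def inj_swap)
  qed
  finally show ?thesis by simp
qed


section \<open>Null vectors of positive semi-definite kernels\<close>

lemma psd_kernel_sum_nonneg:
  fixes x :: "nat \<Rightarrow> 'a"
  assumes "psd_kernel M \<kappa>" "\<And>i. i \<in> {1..n} \<Longrightarrow> x i \<in> M"
  shows "0 \<le> (\<Sum>i\<in>{1..n}. \<Sum>j\<in>{1..n}. c i * c j * \<kappa> (x i) (x j))"
proof -
  \<comment> \<open>\<open>psd_kernel\<close> numbers its points from 0, the sample is numbered from
    1.\<close>
  have "0 \<le> (\<Sum>i<n. \<Sum>j<n. c (Suc i) * c (Suc j) * \<kappa> (x (Suc i)) (x (Suc j)))"
    using assms(1)[unfolded psd_kernel_def, THEN conjunct2, rule_format,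
        of n "\<lambda>i. x (Suc i)" "\<lambda>i. c (Suc i)"] assms(2) by simp
  then show ?thesis
    by (simp add: sum.atLeast1_atMost_eq)
qed

text \<open>Cauchy-Schwarz in the reproducing kernel Hilbert space, without building that space:
  adding the point \<open>z\<close> with coefficient \<open>s\<close> to the null combination leaves
  a nonnegative quadratic in \<open>s\<close> without constant term, so its linear coefficient,
  twice the desired sum, is zero.\<close>

lemma psd_kernel_null:
  fixes x :: "nat \<Rightarrow> 'a"
  assumes psd: "psd_kernel M \<kappa>" and x: "\<And>i. i \<in> {1..n} \<Longrightarrow> x i \<in> M" and z: "z \<in> M"
    and null: "(\<Sum>i\<in>{1..n}. \<Sum>j\<in>{1..n}. c i * c j * \<kappa> (x i) (x j)) = 0"
  shows "(\<Sum>j\<in>{1..n}. c j * \<kappa> z (x j)) = 0"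
proof -
  let ?S = "\<Sum>j<n. c (Suc j) * \<kappa> z (x (Suc j))"
  have sym: "\<kappa> (x (Suc i)) z = \<kappa> z (x (Suc i))" if "i < n" for i
    using psd x z that by (auto simp: psd_kernel_def)
  have null': "(\<Sum>i<n. \<Sum>j<n. c (Suc i) * c (Suc j) * \<kappa> (x (Suc i)) (x (Suc j))) = 0"
    using null by (simp add: sum.atLeast1_atMost_eq)
  have "0 \<le> \<kappa> z z * s\<^sup>2 + (2 * ?S) * s" for s
  proof -
    \<comment> \<open>Index 0 lies outside the sample range and holds the extra point
      \<open>z\<close>, with coefficient \<open>s\<close>.\<close>
    define y where "y = (\<lambda>i. if i = 0 then z else x i)"
    define d where "d = (\<lambda>i. if i = 0 then s else c i)"
    have "\<forall>i<Suc n. y i \<in> M"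
      using x z by (auto simp: y_def)
    then have "0 \<le> (\<Sum>i<Suc n. \<Sum>j<Suc n. d i * d j * \<kappa> (y i) (y j))"
      using psd unfolding psd_kernel_def by blast
    also have "\<dots> = s * s * \<kappa> z z + (\<Sum>j<n. s * c (Suc j) * \<kappa> z (x (Suc j)))
        + ((\<Sum>i<n. c (Suc i) * s * \<kappa> (x (Suc i)) z)
          + (\<Sum>i<n. \<Sum>j<n. c (Suc i) * c (Suc j) * \<kappa> (x (Suc i)) (x (Suc j))))"
      by (simp add: sum.lessThan_Suc_shift y_def d_def sum.distrib del: sum.lessThan_Suc)
    also have "(\<Sum>i<n. c (Suc i) * s * \<kappa> (x (Suc i)) z) = s * ?S"
      unfolding sum_distrib_left by (intro sum.cong) (auto simp: sym)
    also have "(\<Sum>j<n. s * c (Suc j) * \<kappa> z (x (Suc j))) = s * ?S"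
      by (simp add: sum_distrib_left mult.assoc)
    finally show ?thesis
      unfolding null' by (simp add: power2_eq_square algebra_simps)
  qed
  then have "2 * ?S = 0"
    by (rule linear_term_zero_of_nonneg)
  then show ?thesis
    by (simp add: sum.atLeast1_atMost_eq)
qed


section \<open>The Stein kernel of an exponential family\<close>

text \<open>\<open>euclidean_gradient\<close> only constrains the definite description
  \<open>tangent_deriv\<close>; once some derivative \<open>l\<close> is known to exist, the pairing
  with \<open>G\<close> is a genuine derivative.\<close>

lemma has_tangent_deriv_euclidean_gradient:
  assumes "euclidean_gradient M f X G" "D \<in> tangent_space M X" "has_tangent_deriv M f X D l"
  shows "has_tangent_deriv M f X D (frob G D)"
  using assms tangent_deriv_eqI[OF assms(2,3)] by (simp add: euclidean_gradient_def)

lemma linear_inner_matrix_vector: "linear (\<lambda>A::real^'n^'m. u \<bullet> (A *v v))"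
  by (intro linearI) (simp_all add: matrix_vector_mult_add_rdistrib inner_add_right
      flip: scaleR_matrix_vector_assoc)

lemma inner_matrix_sum_pairs:
  fixes A B :: "real^'n^'m"
  shows "A \<bullet> B = (\<Sum>(a, b)\<in>UNIV. A $ a $ b * B $ a $ b)"
  by (simp add: inner_vec_def sum.cartesian_product)

text \<open>Gathers the assumptions on the model and the kernel, separate from those on sample and
  weights.\<close>

locale grassmann_exponential_family =
  fixes r :: nat
    and \<kappa> :: "'n::{finite,linorder} sqmat \<Rightarrow> 'n sqmat \<Rightarrow> real"
    and \<zeta> :: "'n sqmat \<Rightarrow> real^'s"
    and \<eta> :: "'n sqmat \<Rightarrow> real"
    and p :: "real^'s \<Rightarrow> 'n sqmat \<Rightarrow> real"
    and g :: "'s \<Rightarrow> 'n sqmat \<Rightarrow> 'n sqmat"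
    and h :: "'n sqmat \<Rightarrow> 'n sqmat \<Rightarrow> 'n sqmat"
  assumes kernel: "psd_kernel (grassmann r) \<kappa>"
    and kernel_pos: "\<forall>X\<in>grassmann r. \<forall>Y\<in>grassmann r. 0 < \<kappa> X Y"
    and kernel_C11: "C11_on (grassmann r) \<kappa>"
    and zeta: "C1_on (grassmann r) \<zeta>"
    and eta: "C1_on (grassmann r) \<eta>"
    and density: "\<forall>\<theta>. \<exists>Z>0. \<forall>X\<in>grassmann r. p \<theta> X = exp (\<theta> \<bullet> \<zeta> X + \<eta> X) / Z"
    and grad_zeta: "\<forall>k. \<forall>X\<in>grassmann r. euclidean_gradient (grassmann r) (\<lambda>X'. \<zeta> X' $ k) X (g k X)"
    and grad_log: "\<forall>X\<in>grassmann r. \<forall>Y\<in>grassmann r.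
          euclidean_gradient (grassmann r) (\<lambda>X'. \<eta> X' + ln (\<kappa> X' Y)) X (h X Y)"
begin

text \<open>A function's derivatives along the Killing fields are encoded by one skew matrix, an
  infinitesimal rotation. This one belongs to the inner product of \<theta> and \<zeta>;
  \<open>base_rotation\<close> belongs to the part of the log-density times kernel that is free of
  \<theta>.\<close>

definition stat_rotation :: "real^'s \<Rightarrow> 'n sqmat \<Rightarrow> 'n sqmat" where
  "stat_rotation \<theta> X = (\<Sum>k\<in>UNIV. \<theta> $ k *\<^sub>R skew_part (sym_part (g k X) ** X))"

definition base_rotation :: "'n sqmat \<Rightarrow> 'n sqmat \<Rightarrow> 'n sqmat" where
  "base_rotation X Y = skew_part (sym_part (h X Y) ** X)"

lemma kernel_sym: "X \<in> grassmann r \<Longrightarrow> Y \<in> grassmann r \<Longrightarrow> \<kappa> X Y = \<kappa> Y X"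
  using kernel by (auto simp: psd_kernel_def)

lemma has_tangent_deriv_zeta:
  assumes "X \<in> grassmann r" "D \<in> tangent_space (grassmann r) X"
  shows "has_tangent_deriv (grassmann r) (\<lambda>X'. \<zeta> X' $ k) X D (frob (g k X) D)"
  using C1_on_has_tangent_deriv[OF C1_on_component[OF zeta] assms(1)]
    has_tangent_deriv_euclidean_gradient grad_zeta assms by metis

text \<open>The derivative of the kernel is recovered from the gradient \<open>h\<close> by solving
  e + l / \<kappa> = <h, D> for \<open>l\<close>. The number \<open>e\<close> is the derivative of
  \<eta> and hence the same for every \<open>Y\<close>, which is what later lets it be factored out
  of sums over the sample.\<close>

lemma has_tangent_deriv_base:
  assumes "X \<in> grassmann r" "Y \<in> grassmann r" "D \<in> tangent_space (grassmann r) X"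
  obtains e where "has_tangent_deriv (grassmann r) (\<lambda>X'. \<eta> X' + ln (\<kappa> X' Y)) X D (frob (h X Y) D)"
    and "has_tangent_deriv (grassmann r) \<eta> X D e"
    and "has_tangent_deriv (grassmann r) (\<lambda>X'. \<kappa> X' Y) X D (\<kappa> X Y * (frob (h X Y) D - e))"
proof -
  obtain e where e: "has_tangent_deriv (grassmann r) \<eta> X D e"
    using C1_on_has_tangent_deriv[OF eta assms(1)] .
  obtain l where l: "has_tangent_deriv (grassmann r) (\<lambda>X'. \<kappa> X' Y) X D l"
    using C11_on_has_tangent_deriv[OF kernel_C11 assms(1,2)] .
  have pos: "0 < \<kappa> X Y"
    using kernel_pos assms by blast
  have sum: "has_tangent_deriv (grassmann r) (\<lambda>X'. \<eta> X' + ln (\<kappa> X' Y)) X D (e + l / \<kappa> X Y)"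
    by (rule has_tangent_deriv_add[OF e has_tangent_deriv_ln[OF l pos]])
  have grad: "has_tangent_deriv (grassmann r) (\<lambda>X'. \<eta> X' + ln (\<kappa> X' Y)) X D (frob (h X Y) D)"
    using has_tangent_deriv_euclidean_gradient[OF _ assms(3) sum] grad_log assms by blast
  have "e + l / \<kappa> X Y = frob (h X Y) D"
    by (rule has_tangent_deriv_unique[OF assms(3) sum grad])
  then have "l = \<kappa> X Y * (frob (h X Y) D - e)"
    using pos by (simp add: field_simps)
  then show ?thesis
    using that e l grad by blast
qed

lemma killing_log_density:
  assumes "X \<in> grassmann r" "Y \<in> grassmann r"
  shows "killing r i j (\<lambda>X'. ln (p \<theta> X' * \<kappa> X' Y)) X
      = 2 * sqrt 2 * (stat_rotation \<theta> X + base_rotation X Y) $ i $ j"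
proof -
  let ?D = "E_skew i j ** X - X ** E_skew i j"
  have D: "?D \<in> tangent_space (grassmann r) X"
    by (rule E_skew_tangent[OF assms(1)])
  have X: "transpose X = X"
    using assms(1) by (simp add: grassmann_def)
  obtain Z where Z: "0 < Z" "\<forall>X\<in>grassmann r. p \<theta> X = exp (\<theta> \<bullet> \<zeta> X + \<eta> X) / Z"
    using density by blast
  \<comment> \<open>The normalizing constant of the density becomes an additive constant and
    disappears on differentiation.\<close>
  have log: "ln (p \<theta> X' * \<kappa> X' Y) = (\<Sum>k\<in>UNIV. \<theta> $ k * \<zeta> X' $ k) + (\<eta> X' + ln (\<kappa> X' Y)) + - ln Z"
    if "X' \<in> grassmann r" for X'
  proof -
    have "0 < \<kappa> X' Y"
      using kernel_pos that assms by blast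
    then show ?thesis
      using Z that by (simp add: ln_mult ln_div inner_vec_def)
  qed
  have "has_tangent_deriv (grassmann r)
      (\<lambda>X'. (\<Sum>k\<in>UNIV. \<theta> $ k * \<zeta> X' $ k) + (\<eta> X' + ln (\<kappa> X' Y)) + - ln Z) X ?D
      ((\<Sum>k\<in>UNIV. \<theta> $ k * frob (g k X) ?D) + frob (h X Y) ?D + 0)"
    using has_tangent_deriv_base[OF assms D]
    by (intro has_tangent_deriv_add has_tangent_deriv_sum has_tangent_deriv_cmult
        has_tangent_deriv_const has_tangent_deriv_zeta assms(1) D) blast
  then have "has_tangent_deriv (grassmann r) (\<lambda>X'. ln (p \<theta> X' * \<kappa> X' Y)) X ?D
      ((\<Sum>k\<in>UNIV. \<theta> $ k * frob (g k X) ?D) + frob (h X Y) ?D + 0)"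
    using has_tangent_deriv_cong[of "grassmann r" "\<lambda>X'. ln (p \<theta> X' * \<kappa> X' Y)", OF log] by blast
  from tangent_deriv_eqI[OF D this] show ?thesis
    by (simp add: killing_def frob_killing[OF X] stat_rotation_def base_rotation_def
        sum_distrib_left algebra_simps)
qed

lemma inner_stein_Q:
  "\<theta> \<bullet> (stein_Q \<kappa> g X Y *v \<theta>) = \<kappa> X Y * (stat_rotation \<theta> X \<bullet> stat_rotation \<theta> Y)"
  by (simp add: stein_Q_def stat_rotation_def inner_vec_def[of \<theta>] matrix_vector_mult_def
      inner_sum_left inner_sum_right sum_distrib_left frob_eq_inner mult_ac)
    (subst sum.swap, intro sum.cong refl, rule mult.left_commute)

lemma inner_stein_b:
  "stein_b \<kappa> g h X Y \<bullet> \<theta> = \<kappa> X Y * (base_rotation X Y \<bullet> stat_rotation \<theta> Y)"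
  by (simp add: stein_b_def stat_rotation_def base_rotation_def inner_vec_def[of _ \<theta>]
      inner_sum_right sum_distrib_left frob_eq_inner mult_ac)

text \<open>The part of the Stein kernel that does not depend on \<theta>. The mixed second
  derivative of the log-kernel is carried along unevaluated, since it only shifts the
  objective.\<close>

definition base_stein_kernel :: "'n sqmat \<Rightarrow> 'n sqmat \<Rightarrow> real" where
  "base_stein_kernel X Y = \<kappa> X Y * (4 * (base_rotation X Y \<bullet> base_rotation Y X) +
     (\<Sum>(i, j)\<in>{(i, j). i < j}. killing r i j (\<lambda>Y'. killing r i j (\<lambda>X'. ln (\<kappa> X' Y')) X) Y))"

text \<open>Expands \<kappa> times the inner product of two sums of rotations. The cross terms are
  b(X, Y) and b(Y, X), because each base rotation depends on both points, in opposite order.\<close>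

lemma stein_kernel_quadratic:
  assumes X: "X \<in> grassmann r" and Y: "Y \<in> grassmann r"
  shows "stein_kernel r \<kappa> (p \<theta>) X Y
      = 4 * (\<theta> \<bullet> (stein_Q \<kappa> g X Y *v \<theta>) + stein_b \<kappa> g h X Y \<bullet> \<theta> + stein_b \<kappa> g h Y X \<bullet> \<theta>)
        + base_stein_kernel X Y"
proof -
  let ?A = "stat_rotation \<theta> X + base_rotation X Y"
  let ?B = "stat_rotation \<theta> Y + base_rotation Y X"
  \<comment> \<open>Symmetry of the kernel turns the derivative in the second argument into one in
    the first argument at (Y, X).\<close>
  have "ln (p \<theta> Y' * \<kappa> X Y') = ln (p \<theta> Y' * \<kappa> Y' X)" if "Y' \<in> grassmann r" for Y'
    using kernel_sym[OF X that] by simp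
  then have "killing r i j (\<lambda>Y'. ln (p \<theta> Y' * \<kappa> X Y')) Y
      = killing r i j (\<lambda>Y'. ln (p \<theta> Y' * \<kappa> Y' X)) Y" for i j
    unfolding killing_def by (rule tangent_deriv_cong)
  then have kY: "killing r i j (\<lambda>Y'. ln (p \<theta> Y' * \<kappa> X Y')) Y = 2 * sqrt 2 * ?B $ i $ j" for i j
    using killing_log_density[OF Y X] by simp
  have "transpose (stat_rotation \<theta> Z) = - stat_rotation \<theta> Z" for Z
  proof -
    have "stat_rotation \<theta> Z = skew_part (\<Sum>k\<in>UNIV. \<theta> $ k *\<^sub>R (sym_part (g k Z) ** Z))"
      by (simp add: stat_rotation_def skew_part_def transpose_def vec_eq_iff sum_subtractf
          sum_distrib_left algebra_simps)
    then show ?thesis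
      by (simp add: transpose_skew_part)
  qed
  then have skew: "transpose ?A = - ?A" "transpose ?B = - ?B"
    by (simp_all add: transpose_linear_simps base_rotation_def transpose_skew_part)
  \<comment> \<open>Two factors 2 sqrt 2 give 8; the sum over i < j is half the inner product, which
    leaves 4.\<close>
  have "(\<Sum>(i, j)\<in>{(i, j). i < j}. (2 * sqrt 2 * ?A $ i $ j) * (2 * sqrt 2 * ?B $ i $ j))
      = 8 * (\<Sum>(i, j)\<in>{(i, j). i < j}. ?A $ i $ j * ?B $ i $ j)"
    unfolding sum_distrib_left
    by (intro sum.cong refl) (simp add: case_prod_unfold algebra_simps del: vector_add_component)
  also have "\<dots> = 4 * (?A \<bullet> ?B)"
    using inner_skew_upper[OF skew] by simp
  finally have prod: "(\<Sum>(i, j)\<in>{(i, j). i < j}. (2 * sqrt 2 * ?A $ i $ j) * (2 * sqrt 2 * ?B $ i $ j))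
      = 4 * (?A \<bullet> ?B)" .
  have "stein_kernel r \<kappa> (p \<theta>) X Y = \<kappa> X Y * (4 * (?A \<bullet> ?B)
      + (\<Sum>(i, j)\<in>{(i, j). i < j}. killing r i j (\<lambda>Y'. killing r i j (\<lambda>X'. ln (\<kappa> X' Y')) X) Y))"
    unfolding stein_kernel_def kY killing_log_density[OF X Y] prod[symmetric] sum.distrib[symmetric]
    by (simp add: case_prod_unfold)
  also have "\<dots> = 4 * (\<theta> \<bullet> (stein_Q \<kappa> g X Y *v \<theta>) + stein_b \<kappa> g h X Y \<bullet> \<theta> + stein_b \<kappa> g h Y X \<bullet> \<theta>)
        + base_stein_kernel X Y"
    by (simp add: inner_stein_Q inner_stein_b base_stein_kernel_def inner_add_left inner_add_right
        kernel_sym[OF Y X] inner_commute[of "stat_rotation \<theta> X" "base_rotation Y X"] algebra_simps)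
  finally show ?thesis .
qed

text \<open>An arbitrary swap-invariant index set and scale \<open>t\<close> treat both statistics
  at once. Swapping indices makes the sums of b(X, Y) and b(Y, X) equal, whence the factor
  2.\<close>

lemma statistic_quadratic:
  fixes x :: "nat \<Rightarrow> 'n sqmat" and I :: "(nat \<times> nat) set"
  assumes I: "\<And>i j. (i, j) \<in> I \<Longrightarrow> x i \<in> grassmann r" "prod.swap ` I = I"
  shows "t *\<^sub>R (\<Sum>(i, j)\<in>I. (w (x i) * w (x j)) *\<^sub>R stein_kernel r \<kappa> (p \<theta>) (x i) (x j))
    = 4 * (\<theta> \<bullet> ((t *\<^sub>R (\<Sum>(i, j)\<in>I. (w (x i) * w (x j)) *\<^sub>R stein_Q \<kappa> g (x i) (x j))) *v \<theta>)
        + 2 * ((t *\<^sub>R (\<Sum>(i, j)\<in>I. (w (x i) * w (x j)) *\<^sub>R stein_b \<kappa> g h (x i) (x j))) \<bullet> \<theta>))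
      + t *\<^sub>R (\<Sum>(i, j)\<in>I. (w (x i) * w (x j)) *\<^sub>R base_stein_kernel (x i) (x j))"
proof -
  let ?w = "\<lambda>i j. w (x i) * w (x j)"
  have I2: "x j \<in> grassmann r" if "(i, j) \<in> I" for i j
    using I that by (metis image_eqI swap_simp)
  note lin = linear_inner_matrix_vector[of \<theta> \<theta>]
  have swap: "(\<Sum>(i, j)\<in>I. ?w i j * (stein_b \<kappa> g h (x j) (x i) \<bullet> \<theta>))
      = (\<Sum>(i, j)\<in>I. ?w i j * (stein_b \<kappa> g h (x i) (x j) \<bullet> \<theta>))"
    by (subst (2) I(2)[symmetric], subst sum.reindex)
      (simp_all add: case_prod_unfold mult.commute)
  have "(\<Sum>(i, j)\<in>I. ?w i j * stein_kernel r \<kappa> (p \<theta>) (x i) (x j))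
      = (\<Sum>(i, j)\<in>I. 4 * (?w i j * (\<theta> \<bullet> (stein_Q \<kappa> g (x i) (x j) *v \<theta>)))
          + 4 * (?w i j * (stein_b \<kappa> g h (x i) (x j) \<bullet> \<theta>))
          + 4 * (?w i j * (stein_b \<kappa> g h (x j) (x i) \<bullet> \<theta>))
          + ?w i j * base_stein_kernel (x i) (x j))"
    using I(1) I2
    by (intro sum.cong) (auto simp: stein_kernel_quadratic algebra_simps)
  also have "\<dots> = 4 * (\<Sum>(i, j)\<in>I. ?w i j * (\<theta> \<bullet> (stein_Q \<kappa> g (x i) (x j) *v \<theta>)))
      + 8 * (\<Sum>(i, j)\<in>I. ?w i j * (stein_b \<kappa> g h (x i) (x j) \<bullet> \<theta>))
      + (\<Sum>(i, j)\<in>I. ?w i j * base_stein_kernel (x i) (x j))"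
    using swap by (simp add: case_prod_unfold sum.distrib flip: sum_distrib_left)
  finally show ?thesis
    by (simp add: linear_scale[OF lin] linear_sum[OF lin] inner_sum_left case_prod_unfold
        flip: scaleR_matrix_vector_assoc) (simp add: algebra_simps)
qed

section \<open>The V-statistic: semi-definiteness and solvability\<close>

lemma transpose_stein_Q:
  assumes "X \<in> grassmann r" "Y \<in> grassmann r"
  shows "transpose (stein_Q \<kappa> g X Y) = stein_Q \<kappa> g Y X"
  using kernel_sym[OF assms]
  by (simp add: stein_Q_def transpose_def frob_eq_inner inner_commute)

text \<open>Splitting the inner product of rotations into entries shows, for each entry (a, b), a
  full Gram form of \<kappa> on the sample, with the weighted entries as coefficients.\<close>

lemma V_stat_inner_stein_Q:
  fixes x :: "nat \<Rightarrow> 'n sqmat"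
  shows "\<theta> \<bullet> (V_stat n x w (stein_Q \<kappa> g) *v \<theta>) = 1 / (real n)\<^sup>2 * (\<Sum>(a, b)\<in>UNIV. \<Sum>i\<in>{1..n}. \<Sum>j\<in>{1..n}.
    (w (x i) * stat_rotation \<theta> (x i) $ a $ b) * (w (x j) * stat_rotation \<theta> (x j) $ a $ b) * \<kappa> (x i) (x j))"
proof -
  let ?P = "{1..n} \<times> {1..n}"
  have "\<theta> \<bullet> (V_stat n x w (stein_Q \<kappa> g) *v \<theta>)
      = 1 / (real n)\<^sup>2 * (\<Sum>(i, j)\<in>?P. w (x i) * w (x j) * (\<theta> \<bullet> (stein_Q \<kappa> g (x i) (x j) *v \<theta>)))"
    by (simp add: V_stat_def linear_scale[OF linear_inner_matrix_vector] linear_sum[OF linear_inner_matrix_vector]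
        case_prod_unfold)
  also have "(\<Sum>(i, j)\<in>?P. w (x i) * w (x j) * (\<theta> \<bullet> (stein_Q \<kappa> g (x i) (x j) *v \<theta>)))
      = (\<Sum>(i, j)\<in>?P. \<Sum>(a, b)\<in>UNIV. (w (x i) * stat_rotation \<theta> (x i) $ a $ b)
          * (w (x j) * stat_rotation \<theta> (x j) $ a $ b) * \<kappa> (x i) (x j))"
    by (simp add: inner_stein_Q inner_matrix_sum_pairs case_prod_unfold sum_distrib_left mult_ac)
  also have "\<dots> = (\<Sum>(a, b)\<in>UNIV. \<Sum>(i, j)\<in>?P. (w (x i) * stat_rotation \<theta> (x i) $ a $ b)
          * (w (x j) * stat_rotation \<theta> (x j) $ a $ b) * \<kappa> (x i) (x j))"
    unfolding case_prod_unfold by (rule sum.swap)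
  finally show ?thesis
    by (simp add: sum.cartesian_product)
qed

lemma V_stat_stein_Q_psd:
  fixes x :: "nat \<Rightarrow> 'n sqmat"
  assumes x: "\<And>i. i \<in> {1..n} \<Longrightarrow> x i \<in> grassmann r"
  shows "psd_matrix (V_stat n x w (stein_Q \<kappa> g))"
  unfolding psd_matrix_def
proof (intro conjI allI)
  let ?P = "{1..n} \<times> {1..n}"
  have "transpose (\<Sum>(i, j)\<in>?P. (w (x i) * w (x j)) *\<^sub>R stein_Q \<kappa> g (x i) (x j))
      = (\<Sum>(i, j)\<in>?P. (w (x i) * w (x j)) *\<^sub>R transpose (stein_Q \<kappa> g (x i) (x j)))"
    by (simp add: transpose_def vec_eq_iff case_prod_unfold)
  also have "\<dots> = (\<Sum>(i, j)\<in>?P. (w (x j) * w (x i)) *\<^sub>R stein_Q \<kappa> g (x j) (x i))"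
    by (intro sum.cong) (auto simp: transpose_stein_Q x mult.commute)
  also have "\<dots> = (\<Sum>(i, j)\<in>?P. (w (x i) * w (x j)) *\<^sub>R stein_Q \<kappa> g (x i) (x j))"
    unfolding sum.cartesian_product[symmetric] by (rule sum.swap)
  finally show "transpose (V_stat n x w (stein_Q \<kappa> g)) = V_stat n x w (stein_Q \<kappa> g)"
    by (simp add: V_stat_def transpose_linear_simps)
  show "0 \<le> v \<bullet> (V_stat n x w (stein_Q \<kappa> g) *v v)" for v
    unfolding V_stat_inner_stein_Q case_prod_unfold
    by (intro mult_nonneg_nonneg sum_nonneg psd_kernel_sum_nonneg[OF kernel x]) auto
qed

text \<open>The function z \<mapsto> \<Sum> c_j \<kappa>(z, x_j) is zero on the manifold, so its
  derivative along each Killing field is zero as well.\<close>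

lemma sum_base_rotation_zero:
  assumes x: "\<And>i. i \<in> I \<Longrightarrow> x i \<in> grassmann r" and X: "X \<in> grassmann r"
    and null: "\<And>z. z \<in> grassmann r \<Longrightarrow> (\<Sum>j\<in>I. c j * \<kappa> z (x j)) = 0"
  shows "(\<Sum>j\<in>I. c j * (\<kappa> X (x j) * base_rotation X (x j) $ a $ b)) = 0"
proof -
  let ?D = "E_skew a b ** X - X ** E_skew a b"
  have D: "?D \<in> tangent_space (grassmann r) X"
    by (rule E_skew_tangent[OF X])
  obtain e where e: "has_tangent_deriv (grassmann r) \<eta> X ?D e"
    using C1_on_has_tangent_deriv[OF eta X] .
  have "has_tangent_deriv (grassmann r) (\<lambda>z. \<kappa> z (x j)) X ?D (\<kappa> X (x j) * (frob (h X (x j)) ?D - e))"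
    if "j \<in> I" for j
    using has_tangent_deriv_base[OF X x[OF that] D] has_tangent_deriv_unique[OF D e] by metis
  then have "has_tangent_deriv (grassmann r) (\<lambda>z. \<Sum>j\<in>I. c j * \<kappa> z (x j)) X ?D
      (\<Sum>j\<in>I. c j * (\<kappa> X (x j) * (frob (h X (x j)) ?D - e)))"
    by (intro has_tangent_deriv_sum has_tangent_deriv_cmult)
  moreover have "has_tangent_deriv (grassmann r) (\<lambda>z. \<Sum>j\<in>I. c j * \<kappa> z (x j)) X ?D 0"
    using has_tangent_deriv_cong[of "grassmann r" "\<lambda>z. \<Sum>j\<in>I. c j * \<kappa> z (x j)", OF null]
      has_tangent_deriv_const by blast
  ultimately have "(\<Sum>j\<in>I. c j * (\<kappa> X (x j) * (frob (h X (x j)) ?D - e))) = 0"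
    by (rule has_tangent_deriv_unique[OF D])
  \<comment> \<open>The contribution of \<eta> is \<open>e\<close> times the vanishing function
    evaluated at \<open>X\<close>, so only the gradient terms survive.\<close>
  then have "(\<Sum>j\<in>I. c j * (\<kappa> X (x j) * frob (h X (x j)) ?D)) = e * (\<Sum>j\<in>I. c j * \<kappa> X (x j))"
    by (simp add: sum_subtractf sum_distrib_left algebra_simps)
  then have "(\<Sum>j\<in>I. c j * (\<kappa> X (x j) * frob (h X (x j)) ?D)) = 0"
    by (simp add: null[OF X])
  moreover have "frob (h X (x j)) ?D = 2 * sqrt 2 * base_rotation X (x j) $ a $ b" for j
    using X by (simp add: frob_killing base_rotation_def grassmann_def)
  ultimately have "2 * sqrt 2 * (\<Sum>j\<in>I. c j * (\<kappa> X (x j) * base_rotation X (x j) $ a $ b)) = 0"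
    by (simp add: sum_distrib_left mult_ac)
  then show ?thesis
    by simp
qed

text \<open>
  If \<open>v\<close> lies in the kernel of the matrix, then for each entry \<open>(a, b)\<close> the element
  \<open>\<Sum>\<^sub>j c\<^sub>j \<kappa>(\<cdot>, x\<^sub>j)\<close> of the reproducing kernel Hilbert space of \<open>\<kappa>\<close> has norm zero, hence vanishes on the
  manifold together with its derivatives along curves. This is why \<open>b\<close> is orthogonal to \<open>v\<close>.
\<close>

lemma V_stat_stein_b_in_range:
  fixes x :: "nat \<Rightarrow> 'n sqmat"
  assumes n: "0 < n" and x: "\<And>i. i \<in> {1..n} \<Longrightarrow> x i \<in> grassmann r"
  shows "V_stat n x w (stein_b \<kappa> g h) \<in> range (\<lambda>v. V_stat n x w (stein_Q \<kappa> g) *v v)"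
proof (rule mem_range_symmetric_matrixI)
  let ?P = "{1..n} \<times> {1..n}"
  show "transpose (V_stat n x w (stein_Q \<kappa> g)) = V_stat n x w (stein_Q \<kappa> g)"
    using V_stat_stein_Q_psd[OF x] by (simp add: psd_matrix_def)
  fix v assume ker: "V_stat n x w (stein_Q \<kappa> g) *v v = 0"
  define c where "c = (\<lambda>a b j. w (x j) * stat_rotation v (x j) $ a $ b)"
  define T where "T = (\<lambda>(a, b). \<Sum>i\<in>{1..n}. \<Sum>j\<in>{1..n}. c a b i * c a b j * \<kappa> (x i) (x j))"
  have "0 = 1 / (real n)\<^sup>2 * (\<Sum>q\<in>UNIV. T q)"
    using V_stat_inner_stein_Q[of v n x w] by (simp add: ker c_def T_def)
  then have "(\<Sum>q\<in>UNIV. T q) = 0"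
    using n by simp
  moreover have "0 \<le> T q" for q
    unfolding T_def case_prod_unfold by (rule psd_kernel_sum_nonneg[OF kernel x])
  \<comment> \<open>A vanishing sum of nonnegative Gram forms forces each of them to vanish.\<close>
  ultimately have "T (a, b) = 0" for a b
    by (simp add: sum_nonneg_eq_0_iff)
  then have null: "(\<Sum>j\<in>{1..n}. c a b j * \<kappa> z (x j)) = 0" if "z \<in> grassmann r" for a b z
    by (intro psd_kernel_null[OF kernel x that]) (simp_all add: T_def)
  have inner0: "(\<Sum>j\<in>{1..n}. c a b j * (\<kappa> (x i) (x j) * base_rotation (x i) (x j) $ a $ b)) = 0"
    if "i \<in> {1..n}" for a b i
    using that by (intro sum_base_rotation_zero x null)
  have "V_stat n x w (stein_b \<kappa> g h) \<bullet> v
      = 1 / (real n)\<^sup>2 * (\<Sum>(i, j)\<in>?P. w (x i) * w (x j) * (stein_b \<kappa> g h (x i) (x j) \<bullet> v))"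
    by (simp add: V_stat_def inner_sum_left case_prod_unfold)
  also have "(\<Sum>(i, j)\<in>?P. w (x i) * w (x j) * (stein_b \<kappa> g h (x i) (x j) \<bullet> v))
      = (\<Sum>(i, j)\<in>?P. \<Sum>(a, b)\<in>UNIV. w (x i) * (c a b j * (\<kappa> (x i) (x j) * base_rotation (x i) (x j) $ a $ b)))"
    by (simp add: inner_stein_b inner_matrix_sum_pairs case_prod_unfold sum_distrib_left c_def mult_ac)
  also have "\<dots> = (\<Sum>(a, b)\<in>UNIV. \<Sum>(i, j)\<in>?P.
      w (x i) * (c a b j * (\<kappa> (x i) (x j) * base_rotation (x i) (x j) $ a $ b)))"
    unfolding case_prod_unfold by (rule sum.swap)
  \<comment> \<open>For a fixed entry and a fixed first point, the inner sum over \<open>j\<close>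
    is the one that \<open>inner0\<close> shows to be zero.\<close>
  also have "\<dots> = (\<Sum>(a, b)\<in>UNIV. \<Sum>i\<in>{1..n}. w (x i) *
      (\<Sum>j\<in>{1..n}. c a b j * (\<kappa> (x i) (x j) * base_rotation (x i) (x j) $ a $ b)))"
    by (simp add: sum.cartesian_product[symmetric] sum_distrib_left)
  also have "\<dots> = 0"
    unfolding case_prod_unfold by (intro sum.neutral ballI) (simp only: inner0 mult_zero_right)
  finally show "V_stat n x w (stein_b \<kappa> g h) \<bullet> v = 0"
    by simp
qed

end

theorem theorem5p5:
  fixes r n :: nat
    and \<kappa> :: "'n::{finite,linorder} sqmat \<Rightarrow> 'n sqmat \<Rightarrow> real"
    and \<zeta> :: "'n sqmat \<Rightarrow> real^'s"
    and \<eta> :: "'n sqmat \<Rightarrow> real"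
    and p :: "real^'s \<Rightarrow> 'n sqmat \<Rightarrow> real"
    and g :: "'s \<Rightarrow> 'n sqmat \<Rightarrow> 'n sqmat"
    and h :: "'n sqmat \<Rightarrow> 'n sqmat \<Rightarrow> 'n sqmat"
    and x :: "nat \<Rightarrow> 'n sqmat"
    and q :: "'n sqmat \<Rightarrow> real"
    and Qu Qv :: "real^'s^'s"
    and bu bv :: "real^'s"
    and U V :: "real^'s \<Rightarrow> real"
  assumes r: "1 \<le> r" "r \<le> CARD('n)"
    and kernel: "psd_kernel (grassmann r) \<kappa>"
    and kernel_pos: "\<forall>X\<in>grassmann r. \<forall>Y\<in>grassmann r. 0 < \<kappa> X Y"
    and kernel_C11: "C11_on (grassmann r) \<kappa>"
    and zeta: "C1_on (grassmann r) \<zeta>"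
    and eta: "C1_on (grassmann r) \<eta>"
    and density: "\<forall>\<theta>. \<exists>Z>0. \<forall>X\<in>grassmann r. p \<theta> X = exp (\<theta> \<bullet> \<zeta> X + \<eta> X) / Z"
    and grad_zeta: "\<forall>k. \<forall>X\<in>grassmann r. euclidean_gradient (grassmann r) (\<lambda>X'. \<zeta> X' $ k) X (g k X)"
    and grad_log: "\<forall>X\<in>grassmann r. \<forall>Y\<in>grassmann r.
          euclidean_gradient (grassmann r) (\<lambda>X'. \<eta> X' + ln (\<kappa> X' Y)) X (h X Y)"
    and n: "2 \<le> n"
    and sample: "\<forall>i\<in>{1..n}. x i \<in> grassmann r"
    and weight: "\<forall>X\<in>grassmann r. 0 \<le> q X"
    and Qu: "Qu = U_stat n x q (stein_Q \<kappa> g)"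
    and bu: "bu = U_stat n x q (stein_b \<kappa> g h)"
    and Qv: "Qv = V_stat n x q (stein_Q \<kappa> g)"
    and bv: "bv = V_stat n x q (stein_b \<kappa> g h)"
    and U: "U = (\<lambda>\<theta>. U_stat n x q (stein_kernel r \<kappa> (p \<theta>)))"
    and V: "V = (\<lambda>\<theta>. V_stat n x q (stein_kernel r \<kappa> (p \<theta>)))"
    and psd: "psd_matrix Qu"
  shows "(argmin_set U \<noteq> {} \<longleftrightarrow> bu \<in> range (\<lambda>\<theta>. Qu *v \<theta>)) \<and>
     (argmin_set U \<noteq> {} \<longrightarrow>
        argmin_set U =
          {- (moore_penrose Qu *v bu) - (mat 1 - moore_penrose Qu ** Qu) *v y | y. True}) \<and>
     argmin_set V =
          {- (moore_penrose Qv *v bv) - (mat 1 - moore_penrose Qv ** Qv) *v y | y. True}"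
proof -
  interpret grassmann_exponential_family r \<kappa> \<zeta> \<eta> p g h
    by unfold_locales (fact kernel kernel_pos kernel_C11 zeta eta density grad_zeta grad_log)+
  let ?J = "{(i, j). i \<in> {1..n} \<and> j \<in> {1..n} \<and> i \<noteq> j}" and ?P = "{1..n} \<times> {1..n}"
  have x: "x i \<in> grassmann r" if "i \<in> {1..n}" for i
    using sample that by blast
  \<comment> \<open>Both index sets are invariant under exchanging the two indices, so one expansion
    covers \<open>U\<close> and \<open>V\<close>.\<close>
  have "prod.swap ` ?J = ?J" "prod.swap ` ?P = ?P"
    by (auto simp: image_iff)
  then have stat: "t *\<^sub>R (\<Sum>(i, j)\<in>I. (q (x i) * q (x j)) *\<^sub>R stein_kernel r \<kappa> (p \<theta>) (x i) (x j))
    = 4 * (\<theta> \<bullet> ((t *\<^sub>R (\<Sum>(i, j)\<in>I. (q (x i) * q (x j)) *\<^sub>R stein_Q \<kappa> g (x i) (x j))) *v \<theta>)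
        + 2 * ((t *\<^sub>R (\<Sum>(i, j)\<in>I. (q (x i) * q (x j)) *\<^sub>R stein_b \<kappa> g h (x i) (x j))) \<bullet> \<theta>))
      + t *\<^sub>R (\<Sum>(i, j)\<in>I. (q (x i) * q (x j)) *\<^sub>R base_stein_kernel (x i) (x j))"
    if "I = ?J \<or> I = ?P" for I t \<theta>
    using that by (intro statistic_quadratic) (auto intro!: x)
  have U_quad: "U \<theta> = 4 * (\<theta> \<bullet> (Qu *v \<theta>) + 2 * (bu \<bullet> \<theta>)) + U_stat n x q base_stein_kernel" for \<theta>
    unfolding U Qu bu U_stat_def by (rule stat) simp
  have V_quad: "V \<theta> = 4 * (\<theta> \<bullet> (Qv *v \<theta>) + 2 * (bv \<bullet> \<theta>)) + V_stat n x q base_stein_kernel" for \<theta>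
    unfolding V Qv bv V_stat_def by (rule stat) simp
  have argmin_U: "argmin_set U = {\<theta>. Qu *v \<theta> = - bu}"
    by (rule argmin_set_quadratic[OF psd _ U_quad]) simp
  have psd_V: "psd_matrix Qv"
    unfolding Qv using V_stat_stein_Q_psd[OF x] .
  have argmin_V: "argmin_set V = {\<theta>. Qv *v \<theta> = - bv}"
    by (rule argmin_set_quadratic[OF psd_V _ V_quad]) simp
  have range_V: "bv \<in> range (\<lambda>\<theta>. Qv *v \<theta>)"
    unfolding Qv bv using n x by (intro V_stat_stein_b_in_range) auto
  note range_U = argmin_set_quadratic_nonempty[OF argmin_U]
  have "argmin_set U = {- (moore_penrose Qu *v bu) - (mat 1 - moore_penrose Qu ** Qu) *v y | y. True}"
    if "argmin_set U \<noteq> {}"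
    unfolding argmin_U using that range_U psd
    by (intro solutions_moore_penrose) (auto simp: psd_matrix_def)
  moreover have "argmin_set V = {- (moore_penrose Qv *v bv) - (mat 1 - moore_penrose Qv ** Qv) *v y | y. True}"
    unfolding argmin_V using psd_V range_V
    by (intro solutions_moore_penrose) (auto simp: psd_matrix_def)
  ultimately show ?thesis
    using range_U by blast
qed

end
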